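(* Let $f\in Y^*$, let $u \in X_v$ be the solution of $b(u,q)=\langle f,q\rangle_\Omega$ for all $q\in Y$, and let $(p_h,u_H) \in Y_h \times X_H$ be the unique solution of the variational formulations $$\int_\Omega \alpha(x)\,\nabla p_h(x)\cdot\nabla q_h(x)\,dx + b(u_H,q_h) = \langle f,q_h\rangle_\Omega \quad \text{for all } q_h \in Y_h,$$ $$b(z_H,p_h) = 0 \quad \text{for all } z_H \in X_H.$$ Then there holds $$\frac{1}{\sqrt{2}}\,\|p_h\|_Y \leq \|u-u_H\|_{X_v,h}.$$
   Context: $\Omega \subset \mathbb{R}^n$, $n=1,2,3$, is a bounded Lipschitz domain. The diffusion coefficient $\alpha:\Omega\to\mathbb{R}$ is measurable and satisfies $0 < \underline{\alpha} \leq \alpha(x) \leq \overline{\alpha}$ for all $x \in \Omega$, with constants $\underline\alpha,\overline\alpha$. $\boldsymbol{v}$ is a given, possibly unbounded, locally integrable velocity field on $\Omega$ with values in $\mathbb{R}^n$ with (weak) divergence $\operatorname{div}\boldsymbol{v}(x)\le 0$ for almost all $x\in\Omega$. $Y := H^1_0(\Omega)$ is equipped with the norm $\|q\|_Y^2 := \int_\Omega \alpha(x)\,|\nabla q(x)|^2\,dx$, and $Y^*=H^{-1}(\Omega)$ is its dual, with duality pairing $\langle\cdot,\cdot\rangle_\Omega$ extending the $L^2(\Omega)$ inner product. The velocity dependent ansatz space is $X_v := \{u \in Y : \boldsymbol{v}\cdot\nabla u \in Y^*\}$. The bilinear form $b : X_v\times Y\to\mathbb{R}$ is $$b(u,q)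 := \int_\Omega \alpha(x)\,\nabla u(x)\cdot\nabla q(x)\,dx + \int_\Omega \boldsymbol{v}(x)\cdot\nabla u(x)\,q(x)\,dx,$$ where for $u \in X_v$ and $q \in Y$ the last integral is understood as the duality pairing $\langle \boldsymbol{v}\cdot\nabla u, q\rangle_\Omega$. The operator $B:X_v\to Y^*$, $\langle Bu,q\rangle_\Omega = b(u,q)$, is assumed to be bijective. $X_H\subset X_v$ and $Y_h\subset Y$ are conforming (finite dimensional) finite element spaces of piecewise linear continuous functions, where $X_H$ is defined on an admissible shape regular simplicial decomposition of $\Omega$ and $Y_h$ on a refinement of it, so that $X_H\subset Y_h$, $X_H\ne Y_h$. For $u \in X_v$, $w_{u,h} \in Y_h$ is the unique solution of $$\int_\Omega \alpha(x)\,\nabla w_{u,h}(x)\cdot\nabla q_h(x)\,dx = \int_\Omega \boldsymbol{v}(x)\cdot\nabla u(x)\,q_h(x)\,dx \quad \text{for all } q_h \in Y_h,$$ and the discrete norm is $\|u\|_{X_v,h} := \sqrt{\|u\|_Y^2 + \|w_{u,h}\|_Y^2}$. *)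

theory Defs
  imports "HOL-Analysis.Analysis"
begin

section \<open>Lipschitz domains and test functions\<close>

text \<open>Near each boundary point the domain is one side of the graph of a Lipschitz function
  over the hyperplane orthogonal to a unit vector \<open>e\<close>; the choice of \<open>e\<close> plays the role
  of the rotation to local coordinates.\<close>

definition lipschitz_domain :: "'a::euclidean_space set \<Rightarrow> bool" where
  "lipschitz_domain \<Omega> \<longleftrightarrow>
     open \<Omega> \<and> connected \<Omega> \<and> \<Omega> \<noteq> {} \<and>
     (\<forall>x\<in>frontier \<Omega>. \<exists>e r L \<gamma>. norm e = 1 \<and> r > 0 \<and> L-lipschitz_on {y. y \<bullet> e = 0} \<gamma> \<and>
        \<Omega> \<inter> ball x r = {y \<in> ball x r. y \<bullet> e > \<gamma> (y - (y \<bullet> e) *\<^sub>R e)})"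

primrec C_diff :: "nat \<Rightarrow> ('a::euclidean_space \<Rightarrow> real) \<Rightarrow> bool" where
  "C_diff 0 f \<longleftrightarrow> continuous_on UNIV f"
| "C_diff (Suc k) f \<longleftrightarrow> (\<forall>x. f differentiable (at x)) \<and>
     (\<forall>e\<in>Basis. C_diff k (\<lambda>x. frechet_derivative f (at x) e))"

definition test_funs :: "'a::euclidean_space set \<Rightarrow> ('a \<Rightarrow> real) set" where
  "test_funs \<Omega> = {\<phi>. (\<forall>k. C_diff k \<phi>) \<and> (\<exists>K. compact K \<and> K \<subseteq> \<Omega> \<and> (\<forall>x. x \<notin> K \<longrightarrow> \<phi> x = 0))}"

definition classical_grad :: "('a::euclidean_space \<Rightarrow> real) \<Rightarrow> 'a \<Rightarrow> 'a" where
  "classical_grad \<phi> x = (\<Sum>e\<in>Basis. frechet_derivative \<phi> (at x) e *\<^sub>R e)"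


section \<open>Weak derivatives and Sobolev spaces\<close>

text \<open>Elements of Lebesgue and Sobolev spaces are represented by functions on the whole
  space. Only their restriction to \<open>\<Omega>\<close> matters, and functions that agree almost everywhere
  on \<open>\<Omega>\<close> represent the same element.\<close>

definition locally_integrable ::
    "'a::euclidean_space set \<Rightarrow> ('a \<Rightarrow> 'b::euclidean_space) \<Rightarrow> bool" where
  "locally_integrable \<Omega> g \<longleftrightarrow> (\<forall>K. compact K \<and> K \<subseteq> \<Omega> \<longrightarrow> g absolutely_integrable_on K)"

definition L2_on :: "'a::euclidean_space set \<Rightarrow> ('a \<Rightarrow> 'b::euclidean_space) set" where
  "L2_on \<Omega> = {g. g \<in> borel_measurable (lebesgue_on \<Omega>) \<and>
                 integrable (lebesgue_on \<Omega>) (\<lambda>x. (norm (g x))\<^sup>2)}"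

definition has_weak_grad ::
    "'a::euclidean_space set \<Rightarrow> ('a \<Rightarrow> real) \<Rightarrow> ('a \<Rightarrow> 'a) \<Rightarrow> bool" where
  "has_weak_grad \<Omega> u g \<longleftrightarrow> locally_integrable \<Omega> u \<and> locally_integrable \<Omega> g \<and>
     (\<forall>\<phi>\<in>test_funs \<Omega>. (LINT x|lebesgue_on \<Omega>. u x *\<^sub>R classical_grad \<phi> x)
                     = - (LINT x|lebesgue_on \<Omega>. \<phi> x *\<^sub>R g x))"

definition has_weak_div ::
    "'a::euclidean_space set \<Rightarrow> ('a \<Rightarrow> 'a) \<Rightarrow> ('a \<Rightarrow> real) \<Rightarrow> bool" where
  "has_weak_div \<Omega> v d \<longleftrightarrow> locally_integrable \<Omega> v \<and> locally_integrable \<Omega> d \<and>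
     (\<forall>\<phi>\<in>test_funs \<Omega>. (LINT x|lebesgue_on \<Omega>. v x \<bullet> classical_grad \<phi> x)
                     = - (LINT x|lebesgue_on \<Omega>. d x * \<phi> x))"

text \<open>The weak gradient is determined almost everywhere on \<open>\<Omega>\<close>; some version is chosen.\<close>

definition weak_grad :: "'a::euclidean_space set \<Rightarrow> ('a \<Rightarrow> real) \<Rightarrow> 'a \<Rightarrow> 'a" where
  "weak_grad \<Omega> u = (SOME g. has_weak_grad \<Omega> u g)"

definition H1 :: "'a::euclidean_space set \<Rightarrow> ('a \<Rightarrow> real) set" where
  "H1 \<Omega> = {u \<in> L2_on \<Omega>. \<exists>g\<in>L2_on \<Omega>. has_weak_grad \<Omega> u g}"

definition H1_norm :: "'a::euclidean_space set \<Rightarrow> ('a \<Rightarrow> real) \<Rightarrow> real" where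
  "H1_norm \<Omega> u = sqrt ((LINT x|lebesgue_on \<Omega>. (u x)\<^sup>2)
                     + (LINT x|lebesgue_on \<Omega>. (norm (weak_grad \<Omega> u x))\<^sup>2))"

definition H10 :: "'a::euclidean_space set \<Rightarrow> ('a \<Rightarrow> real) set" where
  "H10 \<Omega> = {u \<in> H1 \<Omega>. \<forall>\<epsilon>>0. \<exists>\<phi>\<in>test_funs \<Omega>. H1_norm \<Omega> (\<lambda>x. u x - \<phi> x) < \<epsilon>}"


section \<open>The energy space, its dual, and the bilinear form\<close>

definition diffusion_form ::
    "'a::euclidean_space set \<Rightarrow> ('a \<Rightarrow> real) \<Rightarrow> ('a \<Rightarrow> real) \<Rightarrow> ('a \<Rightarrow> real) \<Rightarrow> real" where
  "diffusion_form \<Omega> \<alpha> u q = (LINT x|lebesgue_on \<Omega>. \<alpha> x * (weak_grad \<Omega> u x \<bullet> weak_grad \<Omega> q x))"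

definition Y_norm ::
    "'a::euclidean_space set \<Rightarrow> ('a \<Rightarrow> real) \<Rightarrow> ('a \<Rightarrow> real) \<Rightarrow> real" where
  "Y_norm \<Omega> \<alpha> q = sqrt (LINT x|lebesgue_on \<Omega>. \<alpha> x * (norm (weak_grad \<Omega> q x))\<^sup>2)"

text \<open>The bounded linear functionals on \<open>Y = H10 \<Omega>\<close>. They are made extensional so that
  equality of functionals is equality on \<open>Y\<close>. Boundedness in the seminorm \<open>Y_norm\<close> makes them
  respect equality almost everywhere.\<close>

definition Y_dual ::
    "'a::euclidean_space set \<Rightarrow> ('a \<Rightarrow> real) \<Rightarrow> (('a \<Rightarrow> real) \<Rightarrow> real) set" where
  "Y_dual \<Omega> \<alpha> = {F \<in> extensional (H10 \<Omega>).
     (\<forall>q\<in>H10 \<Omega>. \<forall>r\<in>H10 \<Omega>. F (\<lambda>x. q x + r x) = F q + F r) \<and>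
     (\<forall>q\<in>H10 \<Omega>. \<forall>c. F (\<lambda>x. c * q x) = c * F q) \<and>
     (\<exists>C. \<forall>q\<in>H10 \<Omega>. \<bar>F q\<bar> \<le> C * Y_norm \<Omega> \<alpha> q)}"

text \<open>A function \<open>g\<close> is regarded as an element of the dual space in the sense of
  distributions: the pairing with \<open>g\<close> is the integral of \<open>g * \<phi>\<close> for test functions \<open>\<phi>\<close>,
  continuously extended to \<open>Y\<close>. The product \<open>g * q\<close> need not be integrable for general
  \<open>q \<in> Y\<close>.\<close>

definition represents ::
    "'a::euclidean_space set \<Rightarrow> ('a \<Rightarrow> real) \<Rightarrow> (('a \<Rightarrow> real) \<Rightarrow> real) \<Rightarrow> bool" where
  "represents \<Omega> g F \<longleftrightarrow> locally_integrable \<Omega> g \<and>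
     (\<forall>\<phi>\<in>test_funs \<Omega>. F \<phi> = (LINT x|lebesgue_on \<Omega>. g x * \<phi> x))"

definition duality_pairing ::
    "'a::euclidean_space set \<Rightarrow> ('a \<Rightarrow> real) \<Rightarrow> ('a \<Rightarrow> real) \<Rightarrow> ('a \<Rightarrow> real) \<Rightarrow> real" where
  "duality_pairing \<Omega> \<alpha> g q = (THE F. F \<in> Y_dual \<Omega> \<alpha> \<and> represents \<Omega> g F) q"

definition X_space ::
    "'a::euclidean_space set \<Rightarrow> ('a \<Rightarrow> real) \<Rightarrow> ('a \<Rightarrow> 'a) \<Rightarrow> ('a \<Rightarrow> real) set" where
  "X_space \<Omega> \<alpha> v = {u \<in> H10 \<Omega>. \<exists>F\<in>Y_dual \<Omega> \<alpha>. represents \<Omega> (\<lambda>x. v x \<bullet> weak_grad \<Omega> u x) F}"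

definition convection_form ::
    "'a::euclidean_space set \<Rightarrow> ('a \<Rightarrow> real) \<Rightarrow> ('a \<Rightarrow> 'a) \<Rightarrow> ('a \<Rightarrow> real) \<Rightarrow> ('a \<Rightarrow> real) \<Rightarrow> real" where
  "convection_form \<Omega> \<alpha> v u q = duality_pairing \<Omega> \<alpha> (\<lambda>x. v x \<bullet> weak_grad \<Omega> u x) q"

definition b_form ::
    "'a::euclidean_space set \<Rightarrow> ('a \<Rightarrow> real) \<Rightarrow> ('a \<Rightarrow> 'a) \<Rightarrow> ('a \<Rightarrow> real) \<Rightarrow> ('a \<Rightarrow> real) \<Rightarrow> real" where
  "b_form \<Omega> \<alpha> v u q = diffusion_form \<Omega> \<alpha> u q + convection_form \<Omega> \<alpha> v u q"

definition B_op ::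
    "'a::euclidean_space set \<Rightarrow> ('a \<Rightarrow> real) \<Rightarrow> ('a \<Rightarrow> 'a) \<Rightarrow> ('a \<Rightarrow> real) \<Rightarrow> ('a \<Rightarrow> real) \<Rightarrow> real" where
  "B_op \<Omega> \<alpha> v u = restrict (b_form \<Omega> \<alpha> v u) (H10 \<Omega>)"

text \<open>Bijectivity onto the dual space, injectivity being modulo equality almost everywhere.\<close>

definition B_bijective ::
    "'a::euclidean_space set \<Rightarrow> ('a \<Rightarrow> real) \<Rightarrow> ('a \<Rightarrow> 'a) \<Rightarrow> bool" where
  "B_bijective \<Omega> \<alpha> v \<longleftrightarrow> B_op \<Omega> \<alpha> v ` X_space \<Omega> \<alpha> v = Y_dual \<Omega> \<alpha> \<and>
     (\<forall>u\<in>X_space \<Omega> \<alpha> v. \<forall>u'\<in>X_space \<Omega> \<alpha> v.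
        B_op \<Omega> \<alpha> v u = B_op \<Omega> \<alpha> v u' \<longrightarrow> (AE x in lebesgue_on \<Omega>. u x = u' x))"


section \<open>Finite element spaces and the discrete norm\<close>

text \<open>In \<^const>\<open>triangulation\<close> any two simplices meet in a common, possibly empty, face; this
  rules out hanging nodes.\<close>

definition admissible_decomposition :: "'a::euclidean_space set \<Rightarrow> 'a set set \<Rightarrow> bool" where
  "admissible_decomposition \<Omega> \<T> \<longleftrightarrow>
     triangulation \<T> \<and> (\<forall>T\<in>\<T>. int DIM('a) simplex T) \<and> \<Union>\<T> = closure \<Omega>"

definition shape_regular :: "real \<Rightarrow> 'a::euclidean_space set set \<Rightarrow> bool" where
  "shape_regular \<sigma> \<T> \<longleftrightarrow>
     (\<forall>T\<in>\<T>. \<exists>c r. r > 0 \<and> cball c r \<subseteq> T \<and> diameter T \<le> \<sigma> * (2 * r))"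

definition refines :: "'a set set \<Rightarrow> 'a set set \<Rightarrow> bool" where
  "refines \<T>' \<T> \<longleftrightarrow> (\<forall>T'\<in>\<T>'. \<exists>T\<in>\<T>. T' \<subseteq> T)"

text \<open>The values outside \<open>closure \<Omega>\<close> are fixed, so that distinct functions are distinct
  elements of the space.\<close>

definition pw_linear :: "'a::euclidean_space set \<Rightarrow> 'a set set \<Rightarrow> ('a \<Rightarrow> real) set" where
  "pw_linear \<Omega> \<T> = {\<phi>. continuous_on (closure \<Omega>) \<phi> \<and>
     (\<forall>T\<in>\<T>. \<exists>a c. \<forall>x\<in>T. \<phi> x = a \<bullet> x + c) \<and> (\<forall>x. x \<notin> closure \<Omega> \<longrightarrow> \<phi> x = 0)}"

text \<open>\<open>X\<close> is a finite-dimensional space of continuous, piecewise linear functions on the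
  decomposition \<open>\<T>\<close> that conforms to \<open>V\<close>. The boundary condition is part of \<open>V\<close>, and \<open>X\<close> may
  be smaller than \<open>pw_linear \<Omega> \<T> \<inter> V\<close>.\<close>

definition conforming_fe_space ::
    "'a::euclidean_space set \<Rightarrow> 'a set set \<Rightarrow> ('a \<Rightarrow> real) set \<Rightarrow> ('a \<Rightarrow> real) set \<Rightarrow> bool" where
  "conforming_fe_space \<Omega> \<T> V X \<longleftrightarrow> X \<subseteq> pw_linear \<Omega> \<T> \<and> X \<subseteq> V \<and>
     (\<exists>\<Phi>. finite \<Phi> \<and> X = {(\<lambda>x. \<Sum>\<phi>\<in>\<Phi>. c \<phi> * \<phi> x) | c. True})"

definition w_sol ::
    "'a::euclidean_space set \<Rightarrow> ('a \<Rightarrow> real) \<Rightarrow> ('a \<Rightarrow> 'a) \<Rightarrow> ('a \<Rightarrow> real) set \<Rightarrow> ('a \<Rightarrow> real) \<Rightarrow> 'a \<Rightarrow> real" where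
  "w_sol \<Omega> \<alpha> v Yh u =
     (THE w. w \<in> Yh \<and> (\<forall>q\<in>Yh. diffusion_form \<Omega> \<alpha> w q = convection_form \<Omega> \<alpha> v u q))"

definition X_h_norm ::
    "'a::euclidean_space set \<Rightarrow> ('a \<Rightarrow> real) \<Rightarrow> ('a \<Rightarrow> 'a) \<Rightarrow> ('a \<Rightarrow> real) set \<Rightarrow> ('a \<Rightarrow> real) \<Rightarrow> real" where
  "X_h_norm \<Omega> \<alpha> v Yh u = sqrt ((Y_norm \<Omega> \<alpha> u)\<^sup>2 + (Y_norm \<Omega> \<alpha> (w_sol \<Omega> \<alpha> v Yh u))\<^sup>2)"

end

theory Submission
  imports Defs
begin

text \<open>Write $e = u - u_H$ and let $w \in Y_h$ be the discrete Riesz representative of the functional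
$q \mapsto \langle v \cdot \nabla e, q\rangle$. Subtracting the first discrete equation from the
continuous one, tested with functions in $Y_h$ only, shows that the diffusion form satisfies
$a(p_h, q) = b(u, q) - b(u_H, q) = a(e, q) + a(w, q)$ for all $q \in Y_h$. The choice
$q = p_h$ and the Cauchy--Schwarz inequality give $\|p_h\|_Y \le \|e\|_Y + \|w\|_Y$, and
$(s + t)^2 \le 2 (s^2 + t^2)$ turns the right-hand side into $\sqrt 2$ times the discrete norm
of $e$.

Three points of this computation rest on genuine properties of the function spaces.

The weak gradient is a chosen representative, so that $\nabla(u - u_H) = \nabla u - \nabla u_H$
needs uniqueness of weak gradients. This is the fundamental lemma of the calculus of variations,
\<open>fundamental_lemma_of_variations\<close>, for which smooth compactly supported functions approximating
indicators of boxes are built from $\exp(-1/t)$.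

The duality pairing is defined by a unique description. A bounded functional on $H^1_0$ is
determined by its values on test functions, because these lie in $H^1_0$ and are dense there
(\<open>Y_dual_eqI\<close>). That a test function is weakly differentiable with its classical gradient comes
down to the vanishing integral of a derivative (\<open>integral_partial_derivative_zero\<close>).

The function $w$ is also given by a unique description. Existence is the Riesz representation
theorem on a finite-dimensional space (\<open>riesz_representation_fun_span\<close>). Uniqueness needs
definiteness of $a$ on $Y_h$, which follows from the Poincare inequality
(\<open>poincare_test_funs\<close>) and the continuity of finite element functions.\<close>

section \<open>Smooth functions\<close>

lemma frechet_derivative_eqI:
  "(f has_derivative f') (at x) \<Longrightarrow> frechet_derivative f (at x) = f'"
  by (metis frechet_derivative_at)

lemma has_derivative_frechet:
  "f differentiable (at x) \<Longrightarrow> (f has_derivative frechet_derivative f (at x)) (at x)"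
  using frechet_derivative_works by blast

lemma C_diff_Suc_imp: "C_diff (Suc k) f \<Longrightarrow> C_diff k f"
proof (induction k arbitrary: f)
  case 0
  then show ?case
    by (auto simp: continuous_at_imp_continuous_on differentiable_imp_continuous_within)
qed auto

lemma C_diff_const: "C_diff k (\<lambda>x::'a::euclidean_space. c)"
proof (induction k arbitrary: c)
  case (Suc k)
  have "frechet_derivative (\<lambda>x::'a. c) (at x) = (\<lambda>_. 0)" for x
    by (rule frechet_derivative_eqI) (auto intro: derivative_eq_intros)
  then show ?case using Suc by simp
qed simp

lemma C_diff_add:
  "C_diff k f \<Longrightarrow> C_diff k g \<Longrightarrow> C_diff k (\<lambda>x::'a::euclidean_space. f x + g x)"
proof (induction k arbitrary: f g)
  case (Suc k)
  have "frechet_derivative (\<lambda>x. f x + g x) (at x)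
      = (\<lambda>e. frechet_derivative f (at x) e + frechet_derivative g (at x) e)" for x
    using Suc.prems by (intro frechet_derivative_eqI has_derivative_add has_derivative_frechet) auto
  then show ?case using Suc by (auto intro!: differentiable_add)
qed (auto intro: continuous_intros)

lemma C_diff_mult:
  "C_diff k f \<Longrightarrow> C_diff k g \<Longrightarrow> C_diff k (\<lambda>x::'a::euclidean_space. f x * g x)"
proof (induction k arbitrary: f g)
  case (Suc k)
  have "frechet_derivative (\<lambda>x. f x * g x) (at x)
      = (\<lambda>e. f x * frechet_derivative g (at x) e + frechet_derivative f (at x) e * g x)" for x
    using Suc.prems by (intro frechet_derivative_eqI has_derivative_mult has_derivative_frechet) auto
  moreover have "C_diff k f" "C_diff k g"
    using Suc.prems C_diff_Suc_imp by blast+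
  ultimately show ?case using Suc by (auto intro!: C_diff_add differentiable_mult)
qed (auto intro: continuous_intros)

lemma C_diff_prod:
  "(\<And>i. i \<in> I \<Longrightarrow> C_diff k (f i)) \<Longrightarrow> C_diff k (\<lambda>x::'a::euclidean_space. \<Prod>i\<in>I. f i x)"
  by (induction I rule: infinite_finite_induct) (auto intro!: C_diff_mult C_diff_const)

text \<open>The function and all its derivatives are handled at once: differentiating replaces \<open>h j\<close> by
\<open>h (Suc j)\<close> and produces a constant factor, so the induction on \<open>k\<close> closes.\<close>

lemma C_diff_affine_comp:
  assumes "\<And>j t. (h j has_real_derivative h (Suc j) t) (at t)"
  shows "C_diff k (\<lambda>x::'a::euclidean_space. h j (x \<bullet> y + c))"
proof (induction k arbitrary: j)
  case 0
  have "continuous_on UNIV (h j)"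
    using assms by (meson DERIV_continuous continuous_at_imp_continuous_on)
  then show ?case
    by (auto intro!: continuous_intros continuous_on_compose2[of UNIV "h j"])
next
  case (Suc k)
  have D: "((\<lambda>x::'a. h j (x \<bullet> y + c)) has_derivative (\<lambda>e. h (Suc j) (x \<bullet> y + c) * (e \<bullet> y))) (at x)" for x
    by (rule derivative_eq_intros has_field_derivative_imp_has_derivative assms
        has_derivative_compose[of "\<lambda>x. x \<bullet> y + c" "\<lambda>e. e \<bullet> y" x UNIV "h j" "\<lambda>t. h (Suc j) (x \<bullet> y + c) * t"] refl | simp)+
  then have "frechet_derivative (\<lambda>x::'a. h j (x \<bullet> y + c)) (at x)
      = (\<lambda>e. h (Suc j) (x \<bullet> y + c) * (e \<bullet> y))" for x
    by (rule frechet_derivative_eqI)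
  moreover have "(\<lambda>x::'a. h j (x \<bullet> y + c)) differentiable at x" for x
    using D by (meson differentiableI)
  ultimately show ?case using Suc by (auto intro!: C_diff_mult C_diff_const)
qed

lemma C_diff_inner: "C_diff k (\<lambda>x::'a::euclidean_space. x \<bullet> y)"
proof -
  define h :: "nat \<Rightarrow> real \<Rightarrow> real"
    where "h j t = (if j = 0 then t else if j = 1 then 1 else 0)" for j t
  have "(h j has_real_derivative h (Suc j) t) (at t)" for j t
    by (cases j) (auto simp: h_def[abs_def] intro!: derivative_eq_intros)
  from C_diff_affine_comp[of h k 0 y 0, OF this] show ?thesis
    by (simp add: h_def)
qed

text \<open>The function $\exp(-1/t)$, extended by zero to $t \le 0$, is smooth: every derivative has the
form $p(1/t) \exp(-1/t)$ for a polynomial $p$, and any such expression vanishes faster than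
linearly at zero because the exponential beats every polynomial.\<close>

lemma smooth_cutoff_family:
  obtains h :: "nat \<Rightarrow> real \<Rightarrow> real" where
    "\<And>j t. (h j has_real_derivative h (Suc j) t) (at t)"
    "\<And>t. h 0 t = (if t > 0 then exp (- (1 / t)) else 0)"
proof -
  define H :: "real poly \<Rightarrow> real \<Rightarrow> real"
    where "H p t = (if t > 0 then poly p (1 / t) * exp (- (1 / t)) else 0)" for p t
  \<comment> \<open>with $s = 1/t$, the derivative of $p(s) e^{-s}$ in $t$ is $s^2 (p(s) - p'(s)) e^{-s}$\<close>
  define \<delta> :: "real poly \<Rightarrow> real poly" where "\<delta> p = [:0, 0, 1:] * (p - pderiv p)" for p
  have lim: "((\<lambda>t. poly p (1 / t) * exp (- (1 / t))) \<longlongrightarrow> 0) (at_right 0)" for p :: "real poly"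
  proof -
    have "((\<lambda>s. \<Sum>i\<le>degree p. coeff p i * (s ^ i / exp s)) \<longlongrightarrow> (\<Sum>i\<le>degree p. coeff p i * 0)) at_top"
      by (intro tendsto_intros tendsto_power_div_exp_0)
    then have "((\<lambda>s. poly p s * exp (- s)) \<longlongrightarrow> 0) at_top"
      by (simp add: poly_altdef exp_minus field_class.field_divide_inverse sum_distrib_right mult.assoc)
    then have "((\<lambda>t. poly p (inverse t) * exp (- inverse t)) \<longlongrightarrow> 0) (at_right (0::real))"
      by (rule filterlim_compose[OF _ filterlim_inverse_at_top_right])
    then show ?thesis by (simp add: field_class.field_divide_inverse)
  qed
  have der: "(H p has_real_derivative H (\<delta> p) t) (at t)" for p t
  proof -
    consider "t > 0" | "t < 0" | "t = 0" by linarith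
    then show ?thesis
    proof cases
      case 1
      have "((\<lambda>t. poly p (1 / t) * exp (- (1 / t))) has_real_derivative H (\<delta> p) t) (at t)"
        using 1 by (auto intro!: derivative_eq_intros poly_DERIV[THEN DERIV_chain2]
            simp: H_def \<delta>_def field_simps power2_eq_square)
      then show ?thesis
        using 1 by (elim has_field_derivative_transform_within_open[where S = "{0<..}"])
          (auto simp: H_def)
    next
      case 2
      have "((\<lambda>t. 0) has_real_derivative H (\<delta> p) t) (at t)"
        using 2 by (auto simp: H_def)
      then show ?thesis
        using 2 by (elim has_field_derivative_transform_within_open[where S = "{..<0}"])
          (auto simp: H_def)
    next
      case 3
      \<comment> \<open>dividing by \<open>t\<close> raises the polynomial by one degree\<close>
      have "((\<lambda>t. (H p t - H p 0) / (t - 0)) \<longlongrightarrow> 0) (at_right 0)"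
        by (rule Lim_transform_eventually[OF lim[of "pCons 0 p"]])
          (auto simp: H_def eventually_at_right_field intro!: exI[of _ 1])
      moreover have "((\<lambda>t. (H p t - H p 0) / (t - 0)) \<longlongrightarrow> 0) (at_left 0)"
        by (rule Lim_transform_eventually[OF tendsto_const])
          (auto simp: H_def eventually_at_left_field intro!: exI[of _ "-1"])
      ultimately have "((\<lambda>t. (H p t - H p 0) / (t - 0)) \<longlongrightarrow> 0) (at 0)"
        by (simp add: filterlim_split_at)
      then show ?thesis using 3 by (simp add: has_field_derivative_iff H_def)
    qed
  qed
  show thesis
  proof (rule that[of "\<lambda>j. H ((\<delta> ^^ j) [:1:])"])
    show "(H ((\<delta> ^^ j) [:1:]) has_real_derivative H ((\<delta> ^^ Suc j) [:1:]) t) (at t)" for j t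
      using der by simp
    show "H ((\<delta> ^^ 0) [:1:]) t = (if t > 0 then exp (- (1 / t)) else 0)" for t
      by (simp add: H_def)
  qed
qed

section \<open>Test functions and their gradients\<close>

lemma test_funs_C_diff: "\<phi> \<in> test_funs \<Omega> \<Longrightarrow> C_diff k \<phi>"
  by (simp add: test_funs_def)

lemma test_funs_supportE:
  assumes "\<phi> \<in> test_funs \<Omega>"
  obtains K where "compact K" "K \<subseteq> \<Omega>" "\<And>x. x \<notin> K \<Longrightarrow> \<phi> x = 0"
  using assms by (auto simp: test_funs_def)

lemma test_funs_mult_left:
  assumes "\<And>k. C_diff k f" "\<phi> \<in> test_funs \<Omega>"
  shows "(\<lambda>x. f x * \<phi> x) \<in> test_funs \<Omega>"
  using assms by (force simp: test_funs_def intro!: C_diff_mult)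

lemma test_funs_scale: "\<phi> \<in> test_funs \<Omega> \<Longrightarrow> (\<lambda>x. c * \<phi> x) \<in> test_funs \<Omega>"
  by (intro test_funs_mult_left C_diff_const)

lemma test_funs_add:
  assumes "\<phi> \<in> test_funs \<Omega>" "\<psi> \<in> test_funs \<Omega>"
  shows "(\<lambda>x. \<phi> x + \<psi> x) \<in> test_funs \<Omega>"
proof -
  obtain K L where K: "compact K" "K \<subseteq> \<Omega>" "\<And>x. x \<notin> K \<Longrightarrow> \<phi> x = 0"
    and L: "compact L" "L \<subseteq> \<Omega>" "\<And>x. x \<notin> L \<Longrightarrow> \<psi> x = 0"
    using test_funs_supportE assms by metis
  then have "compact (K \<union> L) \<and> K \<union> L \<subseteq> \<Omega> \<and> (\<forall>x. x \<notin> K \<union> L \<longrightarrow> \<phi> x + \<psi> x = 0)"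
    by auto
  moreover have "C_diff k (\<lambda>x. \<phi> x + \<psi> x)" for k
    using assms by (intro C_diff_add test_funs_C_diff)
  ultimately show ?thesis unfolding test_funs_def by blast
qed

lemma test_funs_continuous: "\<phi> \<in> test_funs \<Omega> \<Longrightarrow> continuous_on UNIV \<phi>"
  using test_funs_C_diff[of \<phi> \<Omega> 0] by simp

lemma test_funs_differentiable: "\<phi> \<in> test_funs \<Omega> \<Longrightarrow> \<phi> differentiable (at x)"
  using test_funs_C_diff[of \<phi> \<Omega> 1] by simp

lemma test_funs_has_derivative:
  assumes "\<phi> \<in> test_funs \<Omega>"
  shows "(\<phi> has_derivative (\<lambda>h. classical_grad \<phi> x \<bullet> h)) (at x)"
proof -
  have D: "(\<phi> has_derivative frechet_derivative \<phi> (at x)) (at x)"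
    using assms test_funs_differentiable has_derivative_frechet by blast
  then interpret linear "frechet_derivative \<phi> (at x)"
    by (rule has_derivative_linear)
  have "frechet_derivative \<phi> (at x) h = classical_grad \<phi> x \<bullet> h" for h
  proof -
    have "frechet_derivative \<phi> (at x) h = frechet_derivative \<phi> (at x) (\<Sum>e\<in>Basis. (h \<bullet> e) *\<^sub>R e)"
      by (simp add: euclidean_representation)
    also have "\<dots> = classical_grad \<phi> x \<bullet> h"
      by (simp add: classical_grad_def sum scale inner_sum_left inner_commute[of h] mult.commute)
    finally show ?thesis .
  qed
  then have "frechet_derivative \<phi> (at x) = (\<lambda>h. classical_grad \<phi> x \<bullet> h)" by blast
  then show ?thesis using D by simp
qed

lemma classical_grad_eqI:
  assumes "(\<phi> has_derivative (\<lambda>h. g \<bullet> h)) (at x)"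
  shows "classical_grad \<phi> x = g"
  unfolding classical_grad_def frechet_derivative_eqI[OF assms]
  by (simp add: euclidean_representation)

lemma classical_grad_mult:
  assumes "\<phi> \<in> test_funs \<Omega>" "\<psi> \<in> test_funs \<Omega>"
  shows "classical_grad (\<lambda>x. \<phi> x * \<psi> x) x = \<phi> x *\<^sub>R classical_grad \<psi> x + \<psi> x *\<^sub>R classical_grad \<phi> x"
  using has_derivative_mult[OF assms[THEN test_funs_has_derivative], of x]
  by (intro classical_grad_eqI) (simp add: inner_add_left mult.commute)

lemma classical_grad_continuous:
  assumes "\<phi> \<in> test_funs \<Omega>"
  shows "continuous_on UNIV (classical_grad \<phi>)"
proof -
  have "continuous_on UNIV (\<lambda>x. frechet_derivative \<phi> (at x) e)" if "e \<in> Basis" for e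
    using test_funs_C_diff[OF assms, of 1] that by simp
  then show ?thesis unfolding classical_grad_def by (intro continuous_intros)
qed

lemma classical_grad_zero_outside:
  assumes "compact K" "\<And>x. x \<notin> K \<Longrightarrow> \<phi> x = 0" "x \<notin> K"
  shows "classical_grad \<phi> x = 0"
proof (rule classical_grad_eqI)
  have "((\<lambda>_. 0) has_derivative (\<lambda>h. 0 \<bullet> h)) (at x)" by simp
  then show "(\<phi> has_derivative (\<lambda>h. 0 \<bullet> h)) (at x)"
    by (rule has_derivative_transform_within_open[where s = "- K"])
      (use assms in \<open>auto intro: compact_imp_closed open_Compl\<close>)
qed

lemma compact_support_bounded:
  fixes f :: "'a::euclidean_space \<Rightarrow> 'b::euclidean_space"
  assumes "continuous_on UNIV f" "compact K" "\<And>x. x \<notin> K \<Longrightarrow> f x = 0"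
  obtains M where "M \<ge> 0" "\<And>x. norm (f x) \<le> M"
proof -
  have "bounded (f ` K)"
    using assms compact_continuous_image compact_imp_bounded continuous_on_subset
    by (metis subset_UNIV)
  then obtain M where "M > 0" "\<And>x. x \<in> K \<Longrightarrow> norm (f x) \<le> M"
    by (auto simp: bounded_pos)
  then show thesis
    using assms(3) by (intro that[of M]) (auto, metis less_eq_real_def norm_zero)
qed

lemma compact_support_integrable:
  fixes f :: "'a::euclidean_space \<Rightarrow> 'b::euclidean_space"
  assumes "continuous_on UNIV f" "compact K" "\<And>x. x \<notin> K \<Longrightarrow> f x = 0"
  shows "integrable lborel f"
proof -
  have "integrable lborel (\<lambda>x. indicator K x *\<^sub>R f x)"
    using borel_integrable_compact[of K f] assms continuous_on_subset by blast
  also have "(\<lambda>x. indicator K x *\<^sub>R f x) = f"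
    using assms(3) by (auto simp: indicator_def)
  finally show ?thesis .
qed

text \<open>The difference quotients of a compactly supported function integrate to zero because Lebesgue
measure is invariant under translations, and they converge boundedly to the partial derivative.\<close>

lemma integral_partial_derivative_zero:
  fixes \<phi> :: "'a::euclidean_space \<Rightarrow> real"
  assumes \<phi>: "\<phi> \<in> test_funs \<Omega>"
  shows "(LBINT x. classical_grad \<phi> x \<bullet> e) = 0"
proof -
  define D where "D x = classical_grad \<phi> x \<bullet> e" for x
  obtain K where K: "compact K" "\<And>x. x \<notin> K \<Longrightarrow> \<phi> x = 0"
    using test_funs_supportE[OF \<phi>] by metis
  have cont: "continuous_on UNIV \<phi>" "continuous_on UNIV D"
    unfolding D_def using \<phi> test_funs_continuous classical_grad_continuous
    by (auto intro!: continuous_intros)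
  have D0: "D x = 0" if "x \<notin> K" for x
    using classical_grad_zero_outside[OF K that] by (simp add: D_def)
  obtain M where M: "M \<ge> 0" "\<And>x. norm (D x) \<le> M"
    using compact_support_bounded[OF cont(2) K(1) D0] by blast
  obtain R where R: "\<And>x. x \<in> K \<Longrightarrow> norm x \<le> R"
    using compact_imp_bounded[OF K(1)] by (auto simp: bounded_iff)
  define s where "s n x = real (Suc n) * (\<phi> (x + (1 / real (Suc n)) *\<^sub>R e) - \<phi> x)" for n x
  have line: "((\<lambda>t. \<phi> (x + t *\<^sub>R e)) has_real_derivative D (x + t *\<^sub>R e)) (at t)" for x t
  proof -
    have "((\<lambda>t. \<phi> (x + t *\<^sub>R e)) has_derivative
        (\<lambda>h. classical_grad \<phi> (x + t *\<^sub>R e) \<bullet> (h *\<^sub>R e))) (at t)"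
      by (rule has_derivative_compose[OF _ test_funs_has_derivative[OF \<phi>]])
        (auto intro!: derivative_eq_intros)
    then show ?thesis
      by (simp add: has_field_derivative_def D_def mult.commute[of _ "classical_grad _ _ \<bullet> _"] 
          inner_scaleR_right mult_commute_abs)
  qed
  have int: "integrable lborel \<phi>"
    using compact_support_integrable[OF cont(1) K] .
  have shift: "integrable lborel (\<lambda>x. \<phi> (x + c))" "(LBINT x. \<phi> (x + c)) = (LBINT x. \<phi> x)" for c
  proof -
    have m: "\<phi> \<in> borel_measurable borel"
      using cont(1) by (rule borel_measurable_continuous_onI)
    have "(LBINT x. \<phi> x) = (\<integral>x. \<phi> x \<partial>(distr lborel borel ((+) c)))"
      by (simp add: lborel_distr_plus)
    also have "\<dots> = (LBINT x. \<phi> (c + x))"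
      by (rule integral_distr) (use m in auto)
    finally show "(LBINT x. \<phi> (x + c)) = (LBINT x. \<phi> x)" by (simp add: add.commute)
    have "integrable (distr lborel borel ((+) c)) \<phi>"
      using int by (simp add: lborel_distr_plus)
    then have "integrable lborel (\<lambda>x. \<phi> (c + x))"
      by (rule integrable_distr[rotated]) simp
    then show "integrable lborel (\<lambda>x. \<phi> (x + c))" by (simp add: add.commute)
  qed
  have "(\<lambda>n. LBINT x. s n x) \<longlonglongrightarrow> (LBINT x. D x)"
  proof (rule integral_dominated_convergence)
    show "D \<in> borel_measurable lborel"
      using cont(2) by (simp add: borel_measurable_continuous_onI)
    show "s n \<in> borel_measurable lborel" for n
      unfolding s_def using shift(1) int by (intro borel_measurable_integrable) auto
    show "integrable lborel (\<lambda>x. indicator (cball 0 (R + norm e)) x * M)"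
      by (intro integrable_mult_left integrable_real_indicator)
        (use emeasure_lborel_cball_finite in auto)
    show "AE x in lborel. (\<lambda>n. s n x) \<longlonglongrightarrow> D x"
    proof (rule AE_I2)
      fix x
      have "((\<lambda>h. (\<phi> (x + h *\<^sub>R e) - \<phi> x) / h) \<longlongrightarrow> D x) (at 0)"
        using line[of x 0] by (simp add: DERIV_def)
      moreover have "filterlim (\<lambda>n. 1 / real (Suc n)) (at 0) sequentially"
        by (rule filterlim_atI) (use LIMSEQ_inverse_real_of_nat in \<open>auto simp: inverse_eq_divide\<close>)
      ultimately have "(\<lambda>n. (\<phi> (x + (1 / real (Suc n)) *\<^sub>R e) - \<phi> x) / (1 / real (Suc n))) \<longlonglongrightarrow> D x"
        by (rule filterlim_compose)
      then show "(\<lambda>n. s n x) \<longlonglongrightarrow> D x" by (simp add: s_def mult.commute)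
    qed
    show "AE x in lborel. norm (s n x) \<le> indicator (cball 0 (R + norm e)) x * M" for n
    proof (rule AE_I2)
      fix x
      define t where "t = 1 / real (Suc n)"
      have t: "0 < t" "t \<le> 1" "real (Suc n) = 1 / t" by (auto simp: t_def)
      show "norm (s n x) \<le> indicator (cball 0 (R + norm e)) x * M"
      proof (cases "x \<in> cball 0 (R + norm e)")
        case True
        obtain z where "\<phi> (x + t *\<^sub>R e) - \<phi> (x + 0 *\<^sub>R e) = (t - 0) * D (x + z *\<^sub>R e)"
          using MVT2[OF t(1), of "\<lambda>t. \<phi> (x + t *\<^sub>R e)" "\<lambda>t. D (x + t *\<^sub>R e)"] line by blast
        then have "s n x = D (x + z *\<^sub>R e)"
          using t by (simp add: s_def flip: t_def)
        then show ?thesis using True M by simp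
      next
        case False
        \<comment> \<open>both \<open>x\<close> and its translate miss the support\<close>
        then have "norm x > R + norm e" by auto
        moreover have "norm (t *\<^sub>R e) \<le> norm e"
          using t by (simp add: mult_left_le_one_le)
        moreover have "norm (x + t *\<^sub>R e) \<ge> norm x - norm (t *\<^sub>R e)"
          by (rule norm_diff_ineq)
        ultimately have "x \<notin> K" "x + t *\<^sub>R e \<notin> K"
          using R[of x] R[of "x + t *\<^sub>R e"] norm_ge_zero[of e] by linarith+
        then show ?thesis using False K(2) by (simp add: s_def t_def)
      qed
    qed
  qed
  moreover have "(LBINT x. s n x) = 0" for n
    unfolding s_def using shift int by simp
  ultimately show ?thesis
    by (simp add: LIMSEQ_const_iff D_def)
qed

section \<open>The fundamental lemma of the calculus of variations\<close>

text \<open>On the positive half-line $\exp(-1/(nt)) \to 1$ as $n \to \infty$, while the cutoff vanishes for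
$t \le 0$. A product of such factors, one for each face of the box, therefore tends to the
indicator function.\<close>

lemma smooth_box_indicator_approximation:
  fixes a b :: "'a::euclidean_space"
  obtains \<phi> :: "nat \<Rightarrow> 'a \<Rightarrow> real" where
    "\<And>n k. C_diff k (\<phi> n)" "\<And>n x. 0 \<le> \<phi> n x" "\<And>n x. \<phi> n x \<le> 1"
    "\<And>n x. x \<notin> box a b \<Longrightarrow> \<phi> n x = 0"
    "\<And>x. (\<lambda>n. \<phi> n x) \<longlonglongrightarrow> indicator (box a b) x"
proof -
  obtain h :: "nat \<Rightarrow> real \<Rightarrow> real" where
    h: "\<And>j t. (h j has_real_derivative h (Suc j) t) (at t)"
    and h0: "\<And>t. h 0 t = (if t > 0 then exp (- (1 / t)) else 0)"
    using smooth_cutoff_family by metis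
  have h_bounds: "0 \<le> h 0 t" "h 0 t \<le> 1" for t by (auto simp: h0)
  have h_lim: "(\<lambda>n. h 0 (real (Suc n) * t)) \<longlonglongrightarrow> 1" if "t > 0" for t
  proof -
    have "(\<lambda>n. exp (- (inverse (real (Suc n)) * (1 / t)))) \<longlonglongrightarrow> exp (- (0 * (1 / t)))"
      by (intro tendsto_intros LIMSEQ_inverse_real_of_nat)
    moreover have "real (Suc n) * t > 0" for n using that by simp
    ultimately show ?thesis using that by (simp add: h0 divide_inverse mult.commute)
  qed
  define \<phi> where "\<phi> n x = (\<Prod>i\<in>Basis. h 0 (real (Suc n) * (x \<bullet> i - a \<bullet> i))
      * h 0 (real (Suc n) * (b \<bullet> i - x \<bullet> i)))" for n and x :: 'a
  show thesis
  proof (rule that[of \<phi>])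
    show "C_diff k (\<phi> n)" for n k
    proof -
      have "\<phi> n = (\<lambda>x. \<Prod>i\<in>Basis. h 0 (x \<bullet> (real (Suc n) *\<^sub>R i) + - real (Suc n) * (a \<bullet> i))
          * h 0 (x \<bullet> (- real (Suc n) *\<^sub>R i) + real (Suc n) * (b \<bullet> i)))"
        by (simp add: \<phi>_def fun_eq_iff algebra_simps)
      then show ?thesis
        by (simp only:) (intro C_diff_prod C_diff_mult C_diff_affine_comp h)
    qed
    show "0 \<le> \<phi> n x" "\<phi> n x \<le> 1" for n x
      unfolding \<phi>_def by (auto intro!: prod_nonneg prod_le_1 mult_le_one simp: h_bounds)
    show z: "\<phi> n x = 0" if "x \<notin> box a b" for n x
    proof -
      have "\<exists>i\<in>Basis. x \<bullet> i - a \<bullet> i \<le> 0 \<or> b \<bullet> i - x \<bullet> i \<le> 0"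
        using that by (fastforce simp: mem_box not_less)
      then obtain i where "i \<in> Basis" "x \<bullet> i - a \<bullet> i \<le> 0 \<or> b \<bullet> i - x \<bullet> i \<le> 0"
        by blast
      then have "h 0 (real (Suc n) * (x \<bullet> i - a \<bullet> i)) * h 0 (real (Suc n) * (b \<bullet> i - x \<bullet> i)) = 0"
        unfolding h0 by (auto simp: zero_less_mult_iff)
      with \<open>i \<in> Basis\<close> show ?thesis unfolding \<phi>_def by (auto intro!: prod_zero)
    qed
    show "(\<lambda>n. \<phi> n x) \<longlonglongrightarrow> indicator (box a b) x" for x
    proof (cases "x \<in> box a b")
      case True
      have "(\<lambda>n. \<phi> n x) \<longlonglongrightarrow> (\<Prod>i\<in>(Basis :: 'a set). 1 * 1)"
        unfolding \<phi>_def using True by (intro tendsto_intros h_lim) (auto simp: mem_box)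
      then show ?thesis using True by simp
    qed (simp add: z)
  qed
qed

text \<open>The Borel sets over which \<open>h\<close> integrates to zero form a Dynkin system; it contains the open
boxes, which are stable under intersection and generate the Borel sets. A density that integrates
to zero over every Borel set vanishes almost everywhere.\<close>

lemma AE_zero_if_box_integrals_zero:
  fixes h :: "'a::euclidean_space \<Rightarrow> real"
  assumes int: "integrable lborel h"
    and zero: "\<And>c d. (LBINT x:box c d. h x) = 0" and all: "(LBINT x. h x) = 0"
  shows "AE x in lborel. h x = 0"
proof (rule sigma_finite_measure.density_zero[OF sigma_finite_lborel int])
  let ?G = "range (\<lambda>(a, b). box a b :: 'a set)"
  have si: "set_integrable lborel A h" if "A \<in> sets borel" for A
    using int that unfolding set_integrable_def
    by (intro integrable_mult_indicator) auto
  fix A :: "'a set"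
  assume "A \<in> sets lborel"
  then have A: "A \<in> sigma_sets UNIV ?G"
    by (simp add: borel_eq_box)
  have "Int_stable ?G" "?G \<subseteq> Pow UNIV"
    by (auto simp: Int_stable_def box_Int_box)
  from this A show "(LBINT x:A. h x) = 0"
  proof (induction rule: sigma_sets_induct_disjoint)
    case (basic A)
    then show ?case using zero by auto
  next
    case (compl A)
    then have "A \<in> sets borel" by (simp add: borel_eq_box)
    have "(LBINT x:UNIV. h x) = (LBINT x:A. h x) + (LBINT x:UNIV - A. h x)"
      using \<open>A \<in> sets borel\<close> si by (subst set_integral_Un[symmetric]) auto
    then show ?case using compl all by (simp add: set_lebesgue_integral_def)
  next
    case (union A)
    then have "A i \<in> sets borel" for i by (auto simp: borel_eq_box)
    then have "(LBINT x:(\<Union>i. A i). h x) = (\<Sum>i. LBINT x:A i. h x)"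
      using union(1) si by (intro lebesgue_integral_countable_add) (auto simp: disjoint_family_on_def)
    then show ?case using union by simp
  qed (auto simp: set_lebesgue_integral_def)
qed

text \<open>On a closed box inside \<open>\<Omega>\<close> the function \<open>g\<close> is integrable, and testing it with the
smooth approximations of indicators shows that it integrates to zero over every smaller box.
Since \<open>\<Omega>\<close> is a countable union of closed boxes, this localizes the claim. The passage from
the Lebesgue measurable \<open>g\<close> to a Borel measurable version is needed for the Dynkin argument.\<close>

lemma fundamental_lemma_of_variations:
  fixes g :: "'a::euclidean_space \<Rightarrow> real"
  assumes "open \<Omega>" and loc: "locally_integrable \<Omega> g"
    and zero: "\<And>\<phi>. \<phi> \<in> test_funs \<Omega> \<Longrightarrow> (LINT x|lebesgue_on \<Omega>. \<phi> x * g x) = 0"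
  shows "AE x in lebesgue_on \<Omega>. g x = 0"
proof -
  have AE_box: "AE x in lebesgue. x \<in> cbox a b \<longrightarrow> g x = 0" if sub: "cbox a b \<subseteq> \<Omega>" for a b
  proof -
    define h\<^sub>0 where "h\<^sub>0 x = indicator (cbox a b) x * g x" for x
    have "g absolutely_integrable_on (cbox a b)"
      using loc sub by (auto simp: locally_integrable_def)
    then have int0: "integrable lebesgue h\<^sub>0"
      by (simp add: set_integrable_def h\<^sub>0_def[abs_def])
    then obtain h where hb: "h \<in> borel_measurable lborel" and "AE x in lborel. h\<^sub>0 x = h x"
      using completion_ex_borel_measurable_real[of h\<^sub>0 lborel] borel_measurable_integrable by blast
    then have ae: "AE x in lebesgue. h\<^sub>0 x = h x" by (simp add: AE_completion)
    have hb': "h \<in> borel_measurable lebesgue" using hb by (rule measurable_completion)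
    have "integrable lebesgue h"
      using integrable_cong_AE[OF borel_measurable_integrable[OF int0] hb' ae] int0 by blast
    then have int: "integrable lborel h" using hb by (simp add: integrable_completion)
    have test: "(LBINT x. \<phi> x * h x) = 0" if \<phi>: "\<phi> \<in> test_funs \<Omega>" "\<And>x. x \<notin> box a b \<Longrightarrow> \<phi> x = 0" for \<phi>
    proof -
      have [measurable]: "\<phi> \<in> borel_measurable borel"
        using test_funs_continuous[OF \<phi>(1)] by (rule borel_measurable_continuous_onI)
      have "\<phi> \<in> borel_measurable lborel" by simp
      then have m: "\<phi> \<in> borel_measurable lebesgue" by (rule measurable_completion)
      have "(LBINT x. \<phi> x * h x) = (LINT x|lebesgue. \<phi> x * h x)"
        using hb by (intro integral_completion[symmetric]) simp
      also have "\<dots> = (LINT x|lebesgue. \<phi> x * h\<^sub>0 x)"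
        using ae hb' m int0 by (intro integral_cong_AE) (auto intro!: borel_measurable_times borel_measurable_integrable)
      also have "\<dots> = (LINT x|lebesgue. indicator \<Omega> x *\<^sub>R (\<phi> x * g x))"
        using \<phi>(2) sub box_subset_cbox[of a b]
        by (intro Bochner_Integration.integral_cong) (auto simp: h\<^sub>0_def indicator_def)
      also have "\<dots> = (LINT x|lebesgue_on \<Omega>. \<phi> x * g x)"
        using \<open>open \<Omega>\<close> by (intro integral_restrict_space[symmetric]) auto
      finally show ?thesis using zero[OF \<phi>(1)] by simp
    qed
    have box0: "(LBINT x. indicator (box p q) x * h x) = 0" if pq: "box p q \<subseteq> box a b" for p q
    proof -
      obtain \<phi> :: "nat \<Rightarrow> 'a \<Rightarrow> real" where \<phi>:
        "\<And>n k. C_diff k (\<phi> n)" "\<And>n x. 0 \<le> \<phi> n x" "\<And>n x. \<phi> n x \<le> 1"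
        "\<And>n x. x \<notin> box p q \<Longrightarrow> \<phi> n x = 0"
        "\<And>x. (\<lambda>n. \<phi> n x) \<longlonglongrightarrow> indicator (box p q) x"
        using smooth_box_indicator_approximation by metis
      have out: "\<phi> n x = 0" if "x \<notin> box a b" for n x
        using that pq \<phi>(4) by blast
      then have "\<phi> n x = 0" if "x \<notin> cbox a b" for n x
        using that box_subset_cbox by blast
      then have t: "\<phi> n \<in> test_funs \<Omega>" for n
        unfolding test_funs_def using \<phi>(1) sub by (auto intro!: exI[of _ "cbox a b"])
      have [measurable]: "\<phi> n \<in> borel_measurable borel" for n
        using test_funs_continuous[OF t] by (rule borel_measurable_continuous_onI)
      have "(\<lambda>n. LBINT x. \<phi> n x * h x) \<longlonglongrightarrow> (LBINT x. indicator (box p q) x * h x)"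
      proof (rule integral_dominated_convergence)
        show "integrable lborel (\<lambda>x. \<bar>h x\<bar>)" using int by simp
        show "AE x in lborel. (\<lambda>n. \<phi> n x * h x) \<longlonglongrightarrow> indicator (box p q) x * h x"
          using \<phi>(5) by (intro AE_I2 tendsto_mult tendsto_const)
        show "AE x in lborel. norm (\<phi> n x * h x) \<le> \<bar>h x\<bar>" for n
          using \<phi>(2,3) by (intro AE_I2) (auto simp: abs_mult intro!: mult_left_le_one_le)
      qed (use hb in auto)
      then show ?thesis
        using test[OF t out] by (simp add: LIMSEQ_const_iff)
    qed
    have off: "AE x in lborel. x \<notin> box a b \<longrightarrow> h x = 0"
    proof -
      have "cbox a b - box a b \<in> null_sets lborel"
        by (simp add: null_sets_def emeasure_Diff emeasure_lborel_cbox_eq emeasure_lborel_box_eq box_subset_cbox)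
      then have "AE x in lborel. x \<notin> cbox a b - box a b" by (rule AE_not_in)
      moreover have "AE x in lborel. h\<^sub>0 x = h x" by fact
      ultimately show ?thesis
        by eventually_elim (auto simp: h\<^sub>0_def indicator_def split: if_splits)
    qed
    have cut: "(LBINT x. indicator S x * h x) = (LBINT x. indicator (S \<inter> box a b) x * h x)"
      if "S \<in> sets borel" for S
    proof (rule integral_cong_AE)
      show "AE x in lborel. indicator S x * h x = indicator (S \<inter> box a b) x * h x"
        using off by eventually_elim (auto simp: indicator_def)
    qed (use hb that in auto)
    have "AE x in lborel. h x = 0"
    proof (rule AE_zero_if_box_integrals_zero[OF int])
      show "(LBINT x:box c d. h x) = 0" for c d
      proof -
        obtain p q where "box c d \<inter> box a b = box p q" using box_Int_box by blast
        then show ?thesis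
          using cut[of "box c d"] box0[of p q] by (auto simp: set_lebesgue_integral_def)
      qed
      show "(LBINT x. h x) = 0"
        using cut[of UNIV] box0[of a b] by simp
    qed
    then have "AE x in lebesgue. h x = 0" by (rule AE_completion)
    with ae show ?thesis by eventually_elim (auto simp: h\<^sub>0_def)
  qed
  obtain \<D> where \<D>: "countable \<D>" "\<D> \<subseteq> Pow \<Omega>" "\<And>X. X \<in> \<D> \<Longrightarrow> \<exists>a b. X = cbox a b" "\<Union>\<D> = \<Omega>"
    using open_countable_Union_open_cbox[OF \<open>open \<Omega>\<close>] by metis
  have "AE x in lebesgue. \<forall>X\<in>\<D>. x \<in> X \<longrightarrow> g x = 0"
    using \<D>(1-3) AE_box by (subst AE_ball_countable) (auto, metis PowD subsetD)
  then have "AE x in lebesgue. x \<in> \<Omega> \<longrightarrow> g x = 0"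
    by eventually_elim (use \<D>(4) in blast)
  then show ?thesis
    using \<open>open \<Omega>\<close> by (subst AE_restrict_space_iff) auto
qed

section \<open>Weak gradients and the space H1\<close>

text \<open>Local integrability of \<open>g\<close> gives integrability over the whole of \<open>\<Omega>\<close> once it is multiplied
by a continuous function with compact support. The bilinear map covers products with the test
function and with its gradient alike.\<close>

lemma integrable_test_product:
  fixes g :: "'a::euclidean_space \<Rightarrow> 'b::euclidean_space" and f :: "'a \<Rightarrow> 'c::euclidean_space"
    and B :: "'c \<Rightarrow> 'b \<Rightarrow> 'd::euclidean_space"
  assumes "open \<Omega>" "locally_integrable \<Omega> g" "bilinear B" "continuous_on UNIV f"
    and K: "compact K" "K \<subseteq> \<Omega>" "\<And>x. x \<notin> K \<Longrightarrow> f x = 0"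
  shows "integrable (lebesgue_on \<Omega>) (\<lambda>x. B (f x) (g x))"
proof -
  have K': "K \<in> sets lebesgue" "\<Omega> \<in> sets lebesgue"
    using K(1) \<open>open \<Omega>\<close> by (auto simp: compact_imp_closed)
  have cK: "continuous_on K f" using assms(4) continuous_on_subset by blast
  have "(\<lambda>x. B (f x) (g x)) absolutely_integrable_on K"
  proof (rule absolutely_integrable_bounded_measurable_product[OF assms(3)])
    show "f \<in> borel_measurable (lebesgue_on K)"
      using cK K'(1) by (rule continuous_imp_measurable_on_sets_lebesgue)
    show "bounded (f ` K)"
      using cK K(1) compact_continuous_image compact_imp_bounded by blast
    show "g absolutely_integrable_on K"
      using assms(2) K by (simp add: locally_integrable_def)
  qed (rule K')
  then have "integrable lebesgue (\<lambda>x. indicator K x *\<^sub>R B (f x) (g x))"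
    by (simp add: set_integrable_def)
  also have "(\<lambda>x. indicator K x *\<^sub>R B (f x) (g x)) = (\<lambda>x. indicator \<Omega> x *\<^sub>R B (f x) (g x))"
  proof
    fix x
    show "indicator K x *\<^sub>R B (f x) (g x) = indicator \<Omega> x *\<^sub>R B (f x) (g x)"
      using K(2) K(3)[of x] assms(3) by (cases "x \<in> K") (auto simp: bilinear_lzero)
  qed
  finally show ?thesis
    using K'(2) by (simp add: integrable_restrict_space)
qed

lemma locally_integrable_lincomb:
  assumes "locally_integrable \<Omega> f" "locally_integrable \<Omega> g"
  shows "locally_integrable \<Omega> (\<lambda>x. a *\<^sub>R f x + b *\<^sub>R g x)"
  using assms unfolding locally_integrable_def
  by (auto intro!: set_integral_add absolutely_integrable_scaleR_left)

lemma locally_integrable_inner: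
  assumes "locally_integrable \<Omega> f"
  shows "locally_integrable \<Omega> (\<lambda>x. f x \<bullet> e)"
  using assms unfolding locally_integrable_def
  by (auto intro: absolutely_integrable_linear[OF _ bounded_linear_inner_left, unfolded o_def])

lemma integrable_test_scaleR:
  assumes "open \<Omega>" "locally_integrable \<Omega> g" "\<phi> \<in> test_funs \<Omega>"
  shows "integrable (lebesgue_on \<Omega>) (\<lambda>x. \<phi> x *\<^sub>R g x)"
proof -
  obtain K where "compact K" "K \<subseteq> \<Omega>" "\<And>x. x \<notin> K \<Longrightarrow> \<phi> x = 0"
    using test_funs_supportE assms(3) by metis
  then show ?thesis
    using assms test_funs_continuous bounded_bilinear_scaleR
    by (intro integrable_test_product[where K = K]) (auto simp: bilinear_conv_bounded_bilinear)
qed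

lemma integrable_scaleR_test_grad:
  assumes "open \<Omega>" "locally_integrable \<Omega> u" "\<phi> \<in> test_funs \<Omega>"
  shows "integrable (lebesgue_on \<Omega>) (\<lambda>x. u x *\<^sub>R classical_grad \<phi> x)"
proof -
  obtain K where K: "compact K" "K \<subseteq> \<Omega>" "\<And>x. x \<notin> K \<Longrightarrow> \<phi> x = 0"
    using test_funs_supportE assms(3) by metis
  have "bounded_bilinear (\<lambda>x y :: real. y *\<^sub>R (x :: 'a))"
    using bounded_bilinear.flip[OF bounded_bilinear_scaleR] .
  then show ?thesis
    using assms K classical_grad_continuous classical_grad_zero_outside[OF K(1,3)]
    by (intro integrable_test_product[where K = K and B = "\<lambda>x y. y *\<^sub>R x"])
      (auto simp: bilinear_conv_bounded_bilinear)
qed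

text \<open>The difference of two weak gradients is annihilated by all test functions, so the fundamental
lemma applies to each of its components.\<close>

lemma has_weak_grad_unique:
  assumes "open \<Omega>" "has_weak_grad \<Omega> u g" "has_weak_grad \<Omega> u h"
  shows "AE x in lebesgue_on \<Omega>. g x = h x"
proof -
  have loc: "locally_integrable \<Omega> g" "locally_integrable \<Omega> h"
    using assms by (auto simp: has_weak_grad_def)
  have "AE x in lebesgue_on \<Omega>. (1 *\<^sub>R g x + (-1) *\<^sub>R h x) \<bullet> e = 0" for e
  proof (rule fundamental_lemma_of_variations[OF \<open>open \<Omega>\<close>])
    show "locally_integrable \<Omega> (\<lambda>x. (1 *\<^sub>R g x + (-1) *\<^sub>R h x) \<bullet> e)"
      by (intro locally_integrable_inner locally_integrable_lincomb loc)
    fix \<phi> assume \<phi>: "\<phi> \<in> test_funs \<Omega>"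
    note int = integrable_test_scaleR[OF \<open>open \<Omega>\<close> loc(1) \<phi>] integrable_test_scaleR[OF \<open>open \<Omega>\<close> loc(2) \<phi>]
    have "(LINT x|lebesgue_on \<Omega>. \<phi> x * ((1 *\<^sub>R g x + (-1) *\<^sub>R h x) \<bullet> e))
        = (LINT x|lebesgue_on \<Omega>. (\<phi> x *\<^sub>R g x - \<phi> x *\<^sub>R h x) \<bullet> e)"
      by (simp add: inner_diff_left algebra_simps)
    also have "\<dots> = ((LINT x|lebesgue_on \<Omega>. \<phi> x *\<^sub>R g x) - (LINT x|lebesgue_on \<Omega>. \<phi> x *\<^sub>R h x)) \<bullet> e"
      using int by simp
    also have "\<dots> = 0"
      using assms(2,3) \<phi> by (simp add: has_weak_grad_def)
    finally show "(LINT x|lebesgue_on \<Omega>. \<phi> x * ((1 *\<^sub>R g x + (-1) *\<^sub>R h x) \<bullet> e)) = 0" .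
  qed
  then have "AE x in lebesgue_on \<Omega>. \<forall>e\<in>Basis. (g x - h x) \<bullet> e = 0"
    by (intro AE_finite_allI) auto
  then show ?thesis
    by eventually_elim (metis euclidean_all_zero_iff eq_iff_diff_eq_0)
qed

lemma has_weak_grad_lincomb:
  assumes "open \<Omega>" "has_weak_grad \<Omega> u g" "has_weak_grad \<Omega> w h"
  shows "has_weak_grad \<Omega> (\<lambda>x. a * u x + b * w x) (\<lambda>x. a *\<^sub>R g x + b *\<^sub>R h x)"
  unfolding has_weak_grad_def
proof (intro conjI ballI)
  have loc: "locally_integrable \<Omega> u" "locally_integrable \<Omega> w"
    "locally_integrable \<Omega> g" "locally_integrable \<Omega> h"
    using assms by (auto simp: has_weak_grad_def)
  show "locally_integrable \<Omega> (\<lambda>x. a * u x + b * w x)"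
    using locally_integrable_lincomb[OF loc(1,2)] by simp
  show "locally_integrable \<Omega> (\<lambda>x. a *\<^sub>R g x + b *\<^sub>R h x)"
    by (intro locally_integrable_lincomb loc)
  fix \<phi> assume \<phi>: "\<phi> \<in> test_funs \<Omega>"
  note int = integrable_scaleR_test_grad[OF \<open>open \<Omega>\<close> loc(1) \<phi>]
    integrable_scaleR_test_grad[OF \<open>open \<Omega>\<close> loc(2) \<phi>]
    integrable_test_scaleR[OF \<open>open \<Omega>\<close> loc(3) \<phi>] integrable_test_scaleR[OF \<open>open \<Omega>\<close> loc(4) \<phi>]
  have "(LINT x|lebesgue_on \<Omega>. (a * u x + b * w x) *\<^sub>R classical_grad \<phi> x)
      = (LINT x|lebesgue_on \<Omega>. a *\<^sub>R (u x *\<^sub>R classical_grad \<phi> x) + b *\<^sub>R (w x *\<^sub>R classical_grad \<phi> x))"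
    by (simp add: scaleR_add_left)
  also have "\<dots> = a *\<^sub>R (LINT x|lebesgue_on \<Omega>. u x *\<^sub>R classical_grad \<phi> x)
      + b *\<^sub>R (LINT x|lebesgue_on \<Omega>. w x *\<^sub>R classical_grad \<phi> x)"
    using Bochner_Integration.integral_add[OF integrable_scaleR_right[OF int(1), of a]
        integrable_scaleR_right[OF int(2), of b]]
    by (simp only: integral_scaleR_right)
  also have "\<dots> = - (a *\<^sub>R (LINT x|lebesgue_on \<Omega>. \<phi> x *\<^sub>R g x) + b *\<^sub>R (LINT x|lebesgue_on \<Omega>. \<phi> x *\<^sub>R h x))"
    using assms(2,3) \<phi> by (simp add: has_weak_grad_def)
  also have "\<dots> = - (LINT x|lebesgue_on \<Omega>. a *\<^sub>R (\<phi> x *\<^sub>R g x) + b *\<^sub>R (\<phi> x *\<^sub>R h x))"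
    using Bochner_Integration.integral_add[OF integrable_scaleR_right[OF int(3), of a]
        integrable_scaleR_right[OF int(4), of b]]
    by (simp only: integral_scaleR_right)
  also have "\<dots> = - (LINT x|lebesgue_on \<Omega>. \<phi> x *\<^sub>R (a *\<^sub>R g x + b *\<^sub>R h x))"
    by (simp add: scaleR_add_right mult.commute)
  finally show "(LINT x|lebesgue_on \<Omega>. (a * u x + b * w x) *\<^sub>R classical_grad \<phi> x)
      = - (LINT x|lebesgue_on \<Omega>. \<phi> x *\<^sub>R (a *\<^sub>R g x + b *\<^sub>R h x))" .
qed

lemma norm_lincomb_squared_le:
  fixes x y :: "'a::real_inner"
  shows "(norm (a *\<^sub>R x + b *\<^sub>R y))\<^sup>2 \<le> 2 * a\<^sup>2 * (norm x)\<^sup>2 + 2 * b\<^sup>2 * (norm y)\<^sup>2"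
proof -
  have "0 \<le> (a *\<^sub>R x - b *\<^sub>R y) \<bullet> (a *\<^sub>R x - b *\<^sub>R y)" by simp
  then show ?thesis unfolding power2_norm_eq_inner
    by (simp add: inner_add_left inner_add_right inner_diff_left
        inner_diff_right inner_commute power2_eq_square algebra_simps)
qed

lemma L2_on_lincomb:
  fixes f g :: "'a::euclidean_space \<Rightarrow> 'b::euclidean_space"
  assumes "f \<in> L2_on \<Omega>" "g \<in> L2_on \<Omega>"
  shows "(\<lambda>x. a *\<^sub>R f x + b *\<^sub>R g x) \<in> L2_on \<Omega>"
proof -
  have m[measurable]: "f \<in> borel_measurable (lebesgue_on \<Omega>)" "g \<in> borel_measurable (lebesgue_on \<Omega>)"
    using assms by (auto simp: L2_on_def)
  have "integrable (lebesgue_on \<Omega>) (\<lambda>x. (norm (a *\<^sub>R f x + b *\<^sub>R g x))\<^sup>2)"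
  proof (rule Bochner_Integration.integrable_bound)
    show "integrable (lebesgue_on \<Omega>) (\<lambda>x. 2 * a\<^sup>2 * (norm (f x))\<^sup>2 + 2 * b\<^sup>2 * (norm (g x))\<^sup>2)"
      using assms by (auto simp: L2_on_def)
    show "AE x in lebesgue_on \<Omega>. norm ((norm (a *\<^sub>R f x + b *\<^sub>R g x))\<^sup>2)
        \<le> norm (2 * a\<^sup>2 * (norm (f x))\<^sup>2 + 2 * b\<^sup>2 * (norm (g x))\<^sup>2)"
    proof (rule AE_I2)
      fix x
      show "norm ((norm (a *\<^sub>R f x + b *\<^sub>R g x))\<^sup>2)
        \<le> norm (2 * a\<^sup>2 * (norm (f x))\<^sup>2 + 2 * b\<^sup>2 * (norm (g x))\<^sup>2)"
        using norm_lincomb_squared_le[of a "f x" b "g x"] by simp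
    qed
  qed measurable
  then show ?thesis by (simp add: L2_on_def)
qed

lemma L2_on_measurable: "f \<in> L2_on \<Omega> \<Longrightarrow> f \<in> borel_measurable (lebesgue_on \<Omega>)"
  by (simp add: L2_on_def)

lemma L2_on_integrable: "f \<in> L2_on \<Omega> \<Longrightarrow> integrable (lebesgue_on \<Omega>) (\<lambda>x. (norm (f x))\<^sup>2)"
  by (simp add: L2_on_def)

lemma L2_on_cong_AE:
  fixes f g :: "'a::euclidean_space \<Rightarrow> 'b::euclidean_space"
  assumes "open \<Omega>" "f \<in> L2_on \<Omega>" and ae: "AE x in lebesgue_on \<Omega>. f x = g x"
  shows "g \<in> L2_on \<Omega>"
proof -
  have \<Omega>: "\<Omega> \<inter> space lebesgue \<in> sets lebesgue" using \<open>open \<Omega>\<close> by auto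
  have "(\<lambda>x. indicator \<Omega> x *\<^sub>R f x) \<in> borel_measurable lebesgue"
    using L2_on_measurable[OF assms(2)] by (simp add: borel_measurable_restrict_space_iff[OF \<Omega>])
  moreover have "AE x in lebesgue. indicator \<Omega> x *\<^sub>R f x = indicator \<Omega> x *\<^sub>R g x"
    using ae unfolding AE_restrict_space_iff[OF \<Omega>]
    by eventually_elim (auto simp: indicator_def)
  ultimately have "(\<lambda>x. indicator \<Omega> x *\<^sub>R g x) \<in> borel_measurable lebesgue"
    by (rule borel_measurable_AE)
  then have m: "g \<in> borel_measurable (lebesgue_on \<Omega>)"
    by (simp add: borel_measurable_restrict_space_iff[OF \<Omega>])
  have "integrable (lebesgue_on \<Omega>) (\<lambda>x. (norm (g x))\<^sup>2)"
  proof (rule integrable_cong_AE_imp[OF L2_on_integrable[OF assms(2)]])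
    show "AE x in lebesgue_on \<Omega>. (norm (f x))\<^sup>2 = (norm (g x))\<^sup>2"
      using ae by eventually_elim simp
  qed (use m in measurable)
  with m show ?thesis by (simp add: L2_on_def)
qed

lemma L2_on_inner_integrable:
  fixes f g :: "'a::euclidean_space \<Rightarrow> 'b::euclidean_space"
  assumes "f \<in> L2_on \<Omega>" "g \<in> L2_on \<Omega>"
  shows "integrable (lebesgue_on \<Omega>) (\<lambda>x. f x \<bullet> g x)"
proof (rule Bochner_Integration.integrable_bound)
  show "integrable (lebesgue_on \<Omega>) (\<lambda>x. (norm (f x))\<^sup>2 + (norm (g x))\<^sup>2)"
    using assms[THEN L2_on_integrable] by simp
  show "AE x in lebesgue_on \<Omega>. norm (f x \<bullet> g x) \<le> norm ((norm (f x))\<^sup>2 + (norm (g x))\<^sup>2)"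
  proof (rule AE_I2)
    fix x
    have "\<bar>f x \<bullet> g x\<bar> \<le> norm (f x) * norm (g x)" by (rule Cauchy_Schwarz_ineq2)
    also have "\<dots> \<le> (norm (f x))\<^sup>2 + (norm (g x))\<^sup>2"
      using sum_squares_bound[of "norm (f x)" "norm (g x)"]
        mult_nonneg_nonneg[OF norm_ge_zero norm_ge_zero, of "f x" "g x"] by linarith
    finally show "norm (f x \<bullet> g x) \<le> norm ((norm (f x))\<^sup>2 + (norm (g x))\<^sup>2)" by simp
  qed
qed (use assms[THEN L2_on_measurable] in measurable)

lemma has_weak_grad_weak_grad: "has_weak_grad \<Omega> u g \<Longrightarrow> has_weak_grad \<Omega> u (weak_grad \<Omega> u)"
  unfolding weak_grad_def by (rule someI[of "has_weak_grad \<Omega> u" g])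

lemma weak_grad_eqI:
  assumes "open \<Omega>" "has_weak_grad \<Omega> u g"
  shows "AE x in lebesgue_on \<Omega>. weak_grad \<Omega> u x = g x"
  by (rule has_weak_grad_unique[OF assms(1) has_weak_grad_weak_grad[OF assms(2)] assms(2)])

lemma H1_has_weak_grad: "u \<in> H1 \<Omega> \<Longrightarrow> has_weak_grad \<Omega> u (weak_grad \<Omega> u)"
  by (auto simp: H1_def intro: has_weak_grad_weak_grad)

lemma H1_weak_grad_L2:
  assumes "open \<Omega>" "u \<in> H1 \<Omega>"
  shows "weak_grad \<Omega> u \<in> L2_on \<Omega>"
proof -
  obtain g where g: "g \<in> L2_on \<Omega>" "has_weak_grad \<Omega> u g"
    using assms(2) by (auto simp: H1_def)
  have "AE x in lebesgue_on \<Omega>. g x = weak_grad \<Omega> u x"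
    using weak_grad_eqI[OF assms(1) g(2)] by eventually_elim simp
  then show ?thesis by (rule L2_on_cong_AE[OF assms(1) g(1)])
qed

lemma H1_L2: "u \<in> H1 \<Omega> \<Longrightarrow> u \<in> L2_on \<Omega>"
  by (simp add: H1_def)

lemma H1_I: "u \<in> L2_on \<Omega> \<Longrightarrow> has_weak_grad \<Omega> u g \<Longrightarrow> g \<in> L2_on \<Omega> \<Longrightarrow> u \<in> H1 \<Omega>"
  by (auto simp: H1_def)

lemma H1_lincomb:
  assumes "open \<Omega>" "u \<in> H1 \<Omega>" "w \<in> H1 \<Omega>"
  shows "(\<lambda>x. a * u x + b * w x) \<in> H1 \<Omega>"
proof (rule H1_I)
  show "(\<lambda>x. a * u x + b * w x) \<in> L2_on \<Omega>"
    using L2_on_lincomb[OF assms(2,3)[THEN H1_L2]] by simp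
  show "has_weak_grad \<Omega> (\<lambda>x. a * u x + b * w x)
      (\<lambda>x. a *\<^sub>R weak_grad \<Omega> u x + b *\<^sub>R weak_grad \<Omega> w x)"
    by (intro has_weak_grad_lincomb assms H1_has_weak_grad)
  show "(\<lambda>x. a *\<^sub>R weak_grad \<Omega> u x + b *\<^sub>R weak_grad \<Omega> w x) \<in> L2_on \<Omega>"
    by (intro L2_on_lincomb H1_weak_grad_L2 assms)
qed

lemma weak_grad_lincomb:
  assumes "open \<Omega>" "u \<in> H1 \<Omega>" "w \<in> H1 \<Omega>"
  shows "AE x in lebesgue_on \<Omega>. weak_grad \<Omega> (\<lambda>x. a * u x + b * w x) x
      = a *\<^sub>R weak_grad \<Omega> u x + b *\<^sub>R weak_grad \<Omega> w x"
  by (intro weak_grad_eqI has_weak_grad_lincomb assms H1_has_weak_grad)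

lemma compact_support_lebesgue_on:
  fixes f :: "'a::euclidean_space \<Rightarrow> 'b::euclidean_space"
  assumes "open \<Omega>" "continuous_on UNIV f" "compact K" "K \<subseteq> \<Omega>" "\<And>x. x \<notin> K \<Longrightarrow> f x = 0"
  shows "f \<in> borel_measurable (lebesgue_on \<Omega>)"
    and "integrable (lebesgue_on \<Omega>) f"
    and "(LINT x|lebesgue_on \<Omega>. f x) = (LBINT x. f x)"
proof -
  have \<Omega>: "\<Omega> \<inter> space lebesgue \<in> sets lebesgue" using \<open>open \<Omega>\<close> by auto
  have m: "f \<in> borel_measurable lborel"
    using assms(2) by (simp add: borel_measurable_continuous_onI)
  have f: "(\<lambda>x. indicator \<Omega> x *\<^sub>R f x) = f"
    using assms(4,5) by (fastforce simp: indicator_def)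
  have "integrable lebesgue f"
    using compact_support_integrable[OF assms(2,3,5)] m by (simp add: integrable_completion)
  then show int: "integrable (lebesgue_on \<Omega>) f"
    by (simp add: integrable_restrict_space[OF \<Omega>] f)
  then show "f \<in> borel_measurable (lebesgue_on \<Omega>)" by (rule borel_measurable_integrable)
  show "(LINT x|lebesgue_on \<Omega>. f x) = (LBINT x. f x)"
    by (simp add: integral_restrict_space[OF \<Omega>] f integral_completion[OF m])
qed

lemma compact_support_L2:
  fixes f :: "'a::euclidean_space \<Rightarrow> 'b::euclidean_space"
  assumes "open \<Omega>" "continuous_on UNIV f" "compact K" "K \<subseteq> \<Omega>" "\<And>x. x \<notin> K \<Longrightarrow> f x = 0"
  shows "f \<in> L2_on \<Omega>"
proof -
  have "continuous_on UNIV (\<lambda>x. (norm (f x))\<^sup>2)" by (intro continuous_intros assms)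
  then have "integrable (lebesgue_on \<Omega>) (\<lambda>x. (norm (f x))\<^sup>2)"
    using assms by (intro compact_support_lebesgue_on(2)[where K = K]) auto
  then show ?thesis
    using compact_support_lebesgue_on(1)[OF assms] by (simp add: L2_on_def)
qed

lemma test_funs_L2: "open \<Omega> \<Longrightarrow> \<phi> \<in> test_funs \<Omega> \<Longrightarrow> \<phi> \<in> L2_on \<Omega>"
  by (metis test_funs_supportE test_funs_continuous compact_support_L2)

lemma classical_grad_L2: "open \<Omega> \<Longrightarrow> \<phi> \<in> test_funs \<Omega> \<Longrightarrow> classical_grad \<phi> \<in> L2_on \<Omega>"
  by (metis test_funs_supportE classical_grad_continuous classical_grad_zero_outside compact_support_L2)

lemma integral_classical_grad_zero:
  assumes "open \<Omega>" "\<phi> \<in> test_funs \<Omega>"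
  shows "(LINT x|lebesgue_on \<Omega>. classical_grad \<phi> x) = 0"
proof -
  obtain K where K: "compact K" "K \<subseteq> \<Omega>" "\<And>x. x \<notin> K \<Longrightarrow> \<phi> x = 0"
    using test_funs_supportE assms(2) by metis
  note g = classical_grad_continuous[OF assms(2)] K(1) classical_grad_zero_outside[OF K(1,3)]
  have "(LBINT x. classical_grad \<phi> x) \<bullet> e = 0" for e
    using integral_partial_derivative_zero[OF assms(2), of e] compact_support_integrable[OF g] by simp
  then have "(LBINT x. classical_grad \<phi> x) = 0" using inner_eq_zero_iff by blast
  then show ?thesis
    using compact_support_lebesgue_on(3)[OF assms(1) g(1) K(1,2)] g(3) by simp
qed

text \<open>Integration by parts for two test functions: the product rule reduces it to the vanishing
integral of the gradient of their product.\<close>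

lemma test_funs_has_weak_grad:
  assumes "open \<Omega>" "\<phi> \<in> test_funs \<Omega>"
  shows "has_weak_grad \<Omega> \<phi> (classical_grad \<phi>)"
  unfolding has_weak_grad_def
proof (intro conjI ballI)
  have loc: "locally_integrable \<Omega> f" if "continuous_on UNIV f" for f :: "'a \<Rightarrow> 'b::euclidean_space"
    unfolding locally_integrable_def
  proof safe
    fix K :: "'a set" assume "compact K"
    then have "integrable lborel (\<lambda>x. indicator K x *\<^sub>R f x)"
      using that by (intro borel_integrable_compact) (auto intro: continuous_on_subset)
    then show "f absolutely_integrable_on K"
      unfolding set_integrable_def using integrable_completion borel_measurable_integrable by blast
  qed
  show l: "locally_integrable \<Omega> \<phi>" "locally_integrable \<Omega> (classical_grad \<phi>)"
    using assms(2) by (auto intro!: loc test_funs_continuous classical_grad_continuous)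
  fix \<psi> assume \<psi>: "\<psi> \<in> test_funs \<Omega>"
  have prod: "(\<lambda>x. \<phi> x * \<psi> x) \<in> test_funs \<Omega>"
    using assms(2) \<psi> by (intro test_funs_mult_left test_funs_C_diff)
  have "0 = (LINT x|lebesgue_on \<Omega>. \<phi> x *\<^sub>R classical_grad \<psi> x + \<psi> x *\<^sub>R classical_grad \<phi> x)"
    using integral_classical_grad_zero[OF assms(1) prod] by (simp add: classical_grad_mult[OF assms(2) \<psi>])
  also have "\<dots> = (LINT x|lebesgue_on \<Omega>. \<phi> x *\<^sub>R classical_grad \<psi> x)
      + (LINT x|lebesgue_on \<Omega>. \<psi> x *\<^sub>R classical_grad \<phi> x)"
    by (intro Bochner_Integration.integral_add integrable_scaleR_test_grad integrable_test_scaleR assms l \<psi>)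
  finally show "(LINT x|lebesgue_on \<Omega>. \<phi> x *\<^sub>R classical_grad \<psi> x)
      = - (LINT x|lebesgue_on \<Omega>. \<psi> x *\<^sub>R classical_grad \<phi> x)"
    by (simp add: eq_neg_iff_add_eq_0)
qed

lemma test_funs_H1: "open \<Omega> \<Longrightarrow> \<phi> \<in> test_funs \<Omega> \<Longrightarrow> \<phi> \<in> H1 \<Omega>"
  by (rule H1_I[OF test_funs_L2 test_funs_has_weak_grad classical_grad_L2])

section \<open>The space H10 and the Poincare inequality\<close>

lemma H1_norm_squared:
  "(H1_norm \<Omega> u)\<^sup>2 = (LINT x|lebesgue_on \<Omega>. (norm (u x))\<^sup>2)
     + (LINT x|lebesgue_on \<Omega>. (norm (weak_grad \<Omega> u x))\<^sup>2)"
  unfolding H1_norm_def by (subst real_sqrt_pow2) (auto intro!: add_nonneg_nonneg integral_nonneg)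

lemma H1_norm_nonneg: "0 \<le> H1_norm \<Omega> u"
  unfolding H1_norm_def by (auto intro!: add_nonneg_nonneg integral_nonneg)

lemma L2_on_lincomb_integral_le:
  fixes f g :: "'a::euclidean_space \<Rightarrow> 'b::euclidean_space"
  assumes "f \<in> L2_on \<Omega>" "g \<in> L2_on \<Omega>"
  shows "(LINT x|lebesgue_on \<Omega>. (norm (a *\<^sub>R f x + b *\<^sub>R g x))\<^sup>2)
     \<le> 2 * a\<^sup>2 * (LINT x|lebesgue_on \<Omega>. (norm (f x))\<^sup>2) + 2 * b\<^sup>2 * (LINT x|lebesgue_on \<Omega>. (norm (g x))\<^sup>2)"
proof -
  note i = assms[THEN L2_on_integrable]
  have "(LINT x|lebesgue_on \<Omega>. (norm (a *\<^sub>R f x + b *\<^sub>R g x))\<^sup>2)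
      \<le> (LINT x|lebesgue_on \<Omega>. 2 * a\<^sup>2 * (norm (f x))\<^sup>2 + 2 * b\<^sup>2 * (norm (g x))\<^sup>2)"
    using i by (intro integral_mono L2_on_integrable L2_on_lincomb assms norm_lincomb_squared_le) auto
  also have "\<dots> = 2 * a\<^sup>2 * (LINT x|lebesgue_on \<Omega>. (norm (f x))\<^sup>2) + 2 * b\<^sup>2 * (LINT x|lebesgue_on \<Omega>. (norm (g x))\<^sup>2)"
    using i by (subst Bochner_Integration.integral_add) auto
  finally show ?thesis .
qed

lemma L2_on_integral_cong_AE:
  fixes f g :: "'a::euclidean_space \<Rightarrow> 'b::euclidean_space"
  assumes "f \<in> L2_on \<Omega>" "g \<in> L2_on \<Omega>" and ae: "AE x in lebesgue_on \<Omega>. f x = g x"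
  shows "(LINT x|lebesgue_on \<Omega>. (norm (f x))\<^sup>2) = (LINT x|lebesgue_on \<Omega>. (norm (g x))\<^sup>2)"
proof (rule integral_cong_AE)
  show "AE x in lebesgue_on \<Omega>. (norm (f x))\<^sup>2 = (norm (g x))\<^sup>2"
    using ae by eventually_elim simp
qed (use assms(1,2)[THEN L2_on_integrable] borel_measurable_integrable in auto)

text \<open>A substitute for the triangle inequality, obtained from the pointwise bound
$|x + y|^2 \le 2 |x|^2 + 2 |y|^2$. The factor 2 is harmless in density arguments.\<close>

lemma H1_norm_lincomb_squared_le:
  assumes "open \<Omega>" "u \<in> H1 \<Omega>" "w \<in> H1 \<Omega>"
  shows "(H1_norm \<Omega> (\<lambda>x. a * u x + b * w x))\<^sup>2 \<le> 2 * a\<^sup>2 * (H1_norm \<Omega> u)\<^sup>2 + 2 * b\<^sup>2 * (H1_norm \<Omega> w)\<^sup>2"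
proof -
  note L = assms(2,3)[THEN H1_L2] and G = H1_weak_grad_L2[OF assms(1,2)] H1_weak_grad_L2[OF assms(1,3)]
  have "(LINT x|lebesgue_on \<Omega>. (norm (weak_grad \<Omega> (\<lambda>x. a * u x + b * w x) x))\<^sup>2)
      = (LINT x|lebesgue_on \<Omega>. (norm (a *\<^sub>R weak_grad \<Omega> u x + b *\<^sub>R weak_grad \<Omega> w x))\<^sup>2)"
    by (intro L2_on_integral_cong_AE weak_grad_lincomb H1_weak_grad_L2 H1_lincomb L2_on_lincomb assms)
  then show ?thesis
    unfolding H1_norm_squared
    using L2_on_lincomb_integral_le[OF L, of a b] L2_on_lincomb_integral_le[OF G, of a b]
    by (simp add: algebra_simps)
qed

lemma H10_H1: "u \<in> H10 \<Omega> \<Longrightarrow> u \<in> H1 \<Omega>"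
  by (simp add: H10_def)

lemma H10_approx:
  assumes "u \<in> H10 \<Omega>" "\<epsilon> > 0"
  obtains \<phi> where "\<phi> \<in> test_funs \<Omega>" "H1_norm \<Omega> (\<lambda>x. 1 * u x + (-1) * \<phi> x) < \<epsilon>"
  using assms by (auto simp: H10_def)

lemma test_funs_H10:
  assumes "open \<Omega>" "\<phi> \<in> test_funs \<Omega>"
  shows "\<phi> \<in> H10 \<Omega>"
proof -
  have "(H1_norm \<Omega> (\<lambda>x. 0 * \<phi> x + 0 * \<phi> x))\<^sup>2 \<le> 0"
    using H1_norm_lincomb_squared_le[OF assms(1) test_funs_H1[OF assms] test_funs_H1[OF assms], of 0 0]
    by simp
  then have "H1_norm \<Omega> (\<lambda>x. \<phi> x - \<phi> x) = 0" by simp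
  then show ?thesis
    using test_funs_H1[OF assms] assms(2) unfolding H10_def by force
qed

lemma H10_lincomb:
  assumes "open \<Omega>" "u \<in> H10 \<Omega>" "w \<in> H10 \<Omega>"
  shows "(\<lambda>x. a * u x + b * w x) \<in> H10 \<Omega>"
  unfolding H10_def
proof safe
  note H = assms(2,3)[THEN H10_H1]
  show "(\<lambda>x. a * u x + b * w x) \<in> H1 \<Omega>" by (intro H1_lincomb assms H)
  fix \<epsilon> :: real assume "\<epsilon> > 0"
  define C where "C = 2 * a\<^sup>2 + 2 * b\<^sup>2 + 1"
  define \<delta> where "\<delta> = \<epsilon> / sqrt C"
  have "C > 0" unfolding C_def by (intro add_nonneg_pos) auto
  then have \<delta>: "\<delta> > 0" "C * \<delta>\<^sup>2 = \<epsilon>\<^sup>2"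
    using \<open>\<epsilon> > 0\<close> by (auto simp: \<delta>_def power_divide)
  obtain \<phi> where \<phi>: "\<phi> \<in> test_funs \<Omega>" "H1_norm \<Omega> (\<lambda>x. 1 * u x + (-1) * \<phi> x) < \<delta>"
    using H10_approx[OF assms(2) \<delta>(1)] by metis
  obtain \<psi> where \<psi>: "\<psi> \<in> test_funs \<Omega>" "H1_norm \<Omega> (\<lambda>x. 1 * w x + (-1) * \<psi> x) < \<delta>"
    using H10_approx[OF assms(3) \<delta>(1)] by metis
  define d where "d = (\<lambda>x. a * (1 * u x + (-1) * \<phi> x) + b * (1 * w x + (-1) * \<psi> x))"
  have "(H1_norm \<Omega> d)\<^sup>2 \<le> 2 * a\<^sup>2 * (H1_norm \<Omega> (\<lambda>x. 1 * u x + (-1) * \<phi> x))\<^sup>2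
      + 2 * b\<^sup>2 * (H1_norm \<Omega> (\<lambda>x. 1 * w x + (-1) * \<psi> x))\<^sup>2"
    unfolding d_def
    by (intro H1_norm_lincomb_squared_le H1_lincomb assms H test_funs_H1 \<phi> \<psi>)
  also have "\<dots> \<le> 2 * a\<^sup>2 * \<delta>\<^sup>2 + 2 * b\<^sup>2 * \<delta>\<^sup>2"
    using \<phi>(2) \<psi>(2) H1_norm_nonneg
    by (intro add_mono mult_left_mono power_mono) (auto intro: less_imp_le)
  also have "\<dots> < C * \<delta>\<^sup>2" using \<delta>(1) by (simp add: C_def algebra_simps)
  finally have small: "H1_norm \<Omega> d < \<epsilon>"
    using \<delta>(2) \<open>\<epsilon> > 0\<close> by (auto intro: power_less_imp_less_base)
  have d: "d = (\<lambda>x. a * u x + b * w x - (a * \<phi> x + b * \<psi> x))"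
    by (simp add: d_def algebra_simps)
  have "(\<lambda>x. a * \<phi> x + b * \<psi> x) \<in> test_funs \<Omega>"
    by (intro test_funs_add test_funs_scale \<phi> \<psi>)
  with small show "\<exists>\<eta>\<in>test_funs \<Omega>. H1_norm \<Omega> (\<lambda>x. a * u x + b * w x - \<eta> x) < \<epsilon>"
    unfolding d by (rule bexI)
qed

lemma H10_scale: "open \<Omega> \<Longrightarrow> u \<in> H10 \<Omega> \<Longrightarrow> (\<lambda>x. c * u x) \<in> H10 \<Omega>"
  using H10_lincomb[of \<Omega> u u c 0] by simp

text \<open>The field $x_e \varphi^2 e$, for a coordinate direction $e$, has compact support, so its
divergence $\varphi^2 + 2 x_e \varphi\, \partial_e \varphi$ integrates to zero. Young's
inequality absorbs half of $\varphi^2$ and bounds the remainder by $2 R^2 |\nabla \varphi|^2$.\<close>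

lemma poincare_test_funs:
  fixes \<phi> :: "'a::euclidean_space \<Rightarrow> real"
  assumes "open \<Omega>" and R: "\<And>x. x \<in> \<Omega> \<Longrightarrow> norm x \<le> R" and \<phi>: "\<phi> \<in> test_funs \<Omega>"
  shows "(LINT x|lebesgue_on \<Omega>. (norm (\<phi> x))\<^sup>2)
     \<le> 4 * R\<^sup>2 * (LINT x|lebesgue_on \<Omega>. (norm (classical_grad \<phi> x))\<^sup>2)"
proof -
  obtain e :: 'a where e: "e \<in> Basis" using nonempty_Basis by blast
  define \<psi> where "\<psi> x = (x \<bullet> e) * (\<phi> x * \<phi> x)" for x
  define g where "g x = classical_grad \<phi> x" for x
  have \<psi>: "\<psi> \<in> test_funs \<Omega>"
    unfolding \<psi>_def[abs_def] by (intro test_funs_mult_left C_diff_inner test_funs_C_diff[OF \<phi>] \<phi>)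
  have grad: "classical_grad \<psi> x = (\<phi> x)\<^sup>2 *\<^sub>R e + (2 * (x \<bullet> e) * \<phi> x) *\<^sub>R g x" for x
  proof (rule classical_grad_eqI)
    note [derivative_intros] = test_funs_has_derivative[OF \<phi>]
    show "(\<psi> has_derivative (\<lambda>h. ((\<phi> x)\<^sup>2 *\<^sub>R e + (2 * (x \<bullet> e) * \<phi> x) *\<^sub>R g x) \<bullet> h)) (at x)"
      unfolding \<psi>_def[abs_def] g_def
      by (auto intro!: derivative_eq_intros
          simp: fun_eq_iff inner_add_left inner_commute power2_eq_square algebra_simps)
  qed
  have int: "integrable (lebesgue_on \<Omega>) (classical_grad \<psi>)"
  proof -
    obtain K where K: "compact K" "K \<subseteq> \<Omega>" "\<And>x. x \<notin> K \<Longrightarrow> \<psi> x = 0"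
      using test_funs_supportE \<psi> by metis
    then show ?thesis
      using assms(1) classical_grad_continuous[OF \<psi>] classical_grad_zero_outside[OF K(1,3)]
      by (intro compact_support_lebesgue_on(2)[where K = K]) auto
  qed
  note i = L2_on_integrable[OF test_funs_L2[OF assms(1) \<phi>]]
    L2_on_integrable[OF classical_grad_L2[OF assms(1) \<phi>], folded g_def]
  have "(LINT x|lebesgue_on \<Omega>. (1 / 2) * (norm (\<phi> x))\<^sup>2 - 2 * R\<^sup>2 * (norm (g x))\<^sup>2)
      \<le> (LINT x|lebesgue_on \<Omega>. classical_grad \<psi> x \<bullet> e)"
  proof (rule integral_mono)
    fix x assume "x \<in> space (lebesgue_on \<Omega>)"
    then have "x \<in> \<Omega>" by simp
    define t where "t = (x \<bullet> e) * (g x \<bullet> e)"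
    have "\<bar>x \<bullet> e\<bar> \<le> R" "\<bar>g x \<bullet> e\<bar> \<le> norm (g x)"
      using R[OF \<open>x \<in> \<Omega>\<close>] Basis_le_norm[OF e] by (auto intro: order_trans)
    then have "\<bar>t\<bar> \<le> R * norm (g x)"
      unfolding t_def abs_mult by (intro mult_mono) auto
    then have "t\<^sup>2 \<le> R\<^sup>2 * (norm (g x))\<^sup>2"
      by (metis abs_le_square_iff abs_ge_self order_trans power_mult_distrib)
    \<comment> \<open>Young's inequality in the form $2 \varphi t \ge - \varphi^2 / 2 - 2 t^2$\<close>
    moreover have "0 \<le> (\<phi> x + 2 * t)\<^sup>2" by simp
    ultimately have "(1 / 2) * (\<phi> x)\<^sup>2 - 2 * (R\<^sup>2 * (norm (g x))\<^sup>2) \<le> (\<phi> x)\<^sup>2 + 2 * \<phi> x * t"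
      by (simp add: power2_eq_square algebra_simps)
    then show "(1 / 2) * (norm (\<phi> x))\<^sup>2 - 2 * R\<^sup>2 * (norm (g x))\<^sup>2 \<le> classical_grad \<psi> x \<bullet> e"
      using e by (simp add: grad t_def inner_add_left mult.assoc mult.left_commute)
  qed (use i int in auto)
  also have "\<dots> = 0"
    using int integral_classical_grad_zero[OF assms(1) \<psi>] by simp
  finally show ?thesis using i by (simp add: g_def)
qed

text \<open>If test functions $\varphi$ converge to $u$ in $H^1$ and $\nabla u = 0$, then
$\nabla \varphi \to 0$, hence $\varphi \to 0$ in $L^2$ by the Poincare inequality, while
$\varphi \to u$.\<close>

lemma H10_zero_grad_imp_zero:
  assumes "open \<Omega>" "bounded \<Omega>" "u \<in> H10 \<Omega>" and zero: "AE x in lebesgue_on \<Omega>. weak_grad \<Omega> u x = 0"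
  shows "AE x in lebesgue_on \<Omega>. u x = 0"
proof -
  obtain R where R: "\<And>x. x \<in> \<Omega> \<Longrightarrow> norm x \<le> R"
    using \<open>bounded \<Omega>\<close> by (auto simp: bounded_iff)
  define C where "C = 2 + 8 * R\<^sup>2"
  have "C > 0" unfolding C_def by (intro add_pos_nonneg) auto
  define I where "I = (LINT x|lebesgue_on \<Omega>. (norm (u x))\<^sup>2)"
  have u: "u \<in> H1 \<Omega>" by (rule H10_H1[OF assms(3)])
  have bound: "I \<le> C * \<epsilon>\<^sup>2" if \<epsilon>: "\<epsilon> > 0" for \<epsilon>
  proof -
    obtain \<phi> where \<phi>: "\<phi> \<in> test_funs \<Omega>" "H1_norm \<Omega> (\<lambda>x. 1 * u x + (-1) * \<phi> x) < \<epsilon>"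
      using H10_approx[OF assms(3) \<epsilon>] by metis
    define d where "d = (\<lambda>x. 1 * u x + (-1) * \<phi> x)"
    have d: "d \<in> H1 \<Omega>"
      unfolding d_def by (intro H1_lincomb assms u test_funs_H1 \<phi>)
    have "(LINT x|lebesgue_on \<Omega>. (norm (classical_grad \<phi> x))\<^sup>2)
        = (LINT x|lebesgue_on \<Omega>. (norm (weak_grad \<Omega> d x))\<^sup>2)"
    proof -
      have "AE x in lebesgue_on \<Omega>. weak_grad \<Omega> d x = 1 *\<^sub>R weak_grad \<Omega> u x + (-1) *\<^sub>R weak_grad \<Omega> \<phi> x"
        unfolding d_def by (intro weak_grad_lincomb assms u test_funs_H1 \<phi>)
      moreover have "AE x in lebesgue_on \<Omega>. weak_grad \<Omega> \<phi> x = classical_grad \<phi> x"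
        by (intro weak_grad_eqI test_funs_has_weak_grad assms \<phi>)
      ultimately have "AE x in lebesgue_on \<Omega>. (-1) *\<^sub>R classical_grad \<phi> x + 0 *\<^sub>R classical_grad \<phi> x = weak_grad \<Omega> d x"
        using zero by eventually_elim simp
      from L2_on_integral_cong_AE[OF _ _ this] show ?thesis
        using L2_on_lincomb[OF classical_grad_L2 classical_grad_L2, OF assms(1) \<phi>(1) assms(1) \<phi>(1), of "-1" 0]
          H1_weak_grad_L2[OF assms(1) d] by simp
    qed
    moreover have "(H1_norm \<Omega> d)\<^sup>2 \<le> \<epsilon>\<^sup>2"
      using \<phi>(2) H1_norm_nonneg[of \<Omega> d] by (intro power_mono) (auto simp: d_def)
    moreover have "0 \<le> (LINT x|lebesgue_on \<Omega>. (norm (weak_grad \<Omega> d x))\<^sup>2)"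
      "0 \<le> (LINT x|lebesgue_on \<Omega>. (norm (d x))\<^sup>2)"
      by (auto intro!: integral_nonneg)
    ultimately have *: "(LINT x|lebesgue_on \<Omega>. (norm (d x))\<^sup>2) \<le> \<epsilon>\<^sup>2"
      "(LINT x|lebesgue_on \<Omega>. (norm (classical_grad \<phi> x))\<^sup>2) \<le> \<epsilon>\<^sup>2"
      unfolding H1_norm_squared by linarith+
    have "I = (LINT x|lebesgue_on \<Omega>. (norm (1 *\<^sub>R d x + 1 *\<^sub>R \<phi> x))\<^sup>2)"
      by (simp add: I_def d_def)
    also have "\<dots> \<le> 2 * 1\<^sup>2 * (LINT x|lebesgue_on \<Omega>. (norm (d x))\<^sup>2)
        + 2 * 1\<^sup>2 * (LINT x|lebesgue_on \<Omega>. (norm (\<phi> x))\<^sup>2)"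
      by (intro L2_on_lincomb_integral_le H1_L2 d test_funs_L2 assms \<phi>)
    also have "\<dots> \<le> 2 * \<epsilon>\<^sup>2 + 2 * (4 * R\<^sup>2 * \<epsilon>\<^sup>2)"
    proof -
      have "4 * R\<^sup>2 * (LINT x|lebesgue_on \<Omega>. (norm (classical_grad \<phi> x))\<^sup>2) \<le> 4 * R\<^sup>2 * \<epsilon>\<^sup>2"
        using *(2) by (intro mult_left_mono) auto
      then show ?thesis
        using poincare_test_funs[OF assms(1) R \<phi>(1)] *(1) by simp
    qed
    finally show ?thesis by (simp add: C_def algebra_simps)
  qed
  have "I \<le> 0"
  proof (rule ccontr)
    assume "\<not> I \<le> 0"
    then have "I > 0" by simp
    then have "I \<le> C * (sqrt (I / (2 * C)))\<^sup>2" using \<open>C > 0\<close> by (intro bound) simp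
    also have "\<dots> = I / 2" using \<open>C > 0\<close> \<open>I > 0\<close> by simp
    finally show False using \<open>I > 0\<close> by simp
  qed
  moreover have "I \<ge> 0" unfolding I_def by (auto intro!: integral_nonneg)
  ultimately have "I = 0" by simp
  then have "AE x in lebesgue_on \<Omega>. (norm (u x))\<^sup>2 = 0"
    using integral_nonneg_eq_0_iff_AE[OF L2_on_integrable[OF H1_L2[OF u]]] by (simp add: I_def)
  then show ?thesis by eventually_elim simp
qed

section \<open>Riesz representation in finite dimensions\<close>

text \<open>The minimum over \<open>t\<close> of a nonnegative quadratic polynomial is nonnegative. It is stated for
real coefficients because the functions in question do not carry the structure of an inner
product space.\<close>

lemma Cauchy_Schwarz_from_quadratic:
  fixes A B C :: real
  assumes "\<And>t. 0 \<le> A + 2 * t * B + t\<^sup>2 * C" "0 \<le> C"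
  shows "B\<^sup>2 \<le> A * C"
proof (cases "C = 0")
  case True
  have "B = 0"
  proof (rule ccontr)
    assume "B \<noteq> 0"
    then show False using assms(1)[of "- (A + 1) / (2 * B)"] True by (simp add: field_simps)
  qed
  then show ?thesis using True by simp
next
  case False
  then have "0 \<le> A - B\<^sup>2 / C"
    using assms(1)[of "- B / C"] by (simp add: power2_eq_square)
  then show ?thesis using False assms(2) by (simp add: field_simps)
qed

text \<open>The linear span of a finite set of functions, with the coefficients indexed by the functions
themselves, as in \<^const>\<open>conforming_fe_space\<close>.\<close>

definition fun_span :: "('x \<Rightarrow> real) set \<Rightarrow> ('x \<Rightarrow> real) set" where
  "fun_span \<Phi> = {(\<lambda>x. \<Sum>\<phi>\<in>\<Phi>. c \<phi> * \<phi> x) | c. True}"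

lemma fun_spanI: "(\<lambda>x. \<Sum>\<phi>\<in>\<Phi>. c \<phi> * \<phi> x) \<in> fun_span \<Phi>"
  unfolding fun_span_def by blast

lemma fun_span_lincomb:
  assumes "p \<in> fun_span \<Phi>" "q \<in> fun_span \<Phi>"
  shows "(\<lambda>x. s * p x + t * q x) \<in> fun_span \<Phi>"
proof -
  obtain c d where "p = (\<lambda>x. \<Sum>\<phi>\<in>\<Phi>. c \<phi> * \<phi> x)" "q = (\<lambda>x. \<Sum>\<phi>\<in>\<Phi>. d \<phi> * \<phi> x)"
    using assms by (auto simp: fun_span_def)
  then have eq: "(\<lambda>x. s * p x + t * q x) = (\<lambda>x. \<Sum>\<phi>\<in>\<Phi>. (s * c \<phi> + t * d \<phi>) * \<phi> x)"
    by (simp add: sum_distrib_left sum.distrib[symmetric] algebra_simps)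
  show ?thesis unfolding eq by (rule fun_spanI)
qed

lemma fun_span_insert:
  assumes "finite \<Phi>" "\<psi> \<notin> \<Phi>"
  shows "q \<in> fun_span (insert \<psi> \<Phi>) \<longleftrightarrow> (\<exists>t. \<exists>r\<in>fun_span \<Phi>. q = (\<lambda>x. t * \<psi> x + r x))"
proof
  assume "q \<in> fun_span (insert \<psi> \<Phi>)"
  then obtain c where "q = (\<lambda>x. \<Sum>\<phi>\<in>insert \<psi> \<Phi>. c \<phi> * \<phi> x)" by (auto simp: fun_span_def)
  then have eq: "q = (\<lambda>x. c \<psi> * \<psi> x + (\<Sum>\<phi>\<in>\<Phi>. c \<phi> * \<phi> x))" using assms by simp
  show "\<exists>t. \<exists>r\<in>fun_span \<Phi>. q = (\<lambda>x. t * \<psi> x + r x)"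
    unfolding eq by (intro exI[of _ "c \<psi>"] bexI[OF _ fun_spanI[of c \<Phi>]]) (rule refl)
next
  assume "\<exists>t. \<exists>r\<in>fun_span \<Phi>. q = (\<lambda>x. t * \<psi> x + r x)"
  then obtain t c where q: "q = (\<lambda>x. t * \<psi> x + (\<Sum>\<phi>\<in>\<Phi>. c \<phi> * \<phi> x))"
    by (auto simp: fun_span_def)
  have "(\<Sum>\<phi>\<in>\<Phi>. (c(\<psi> := t)) \<phi> * \<phi> x) = (\<Sum>\<phi>\<in>\<Phi>. c \<phi> * \<phi> x)" for x
    using assms by (intro sum.cong) auto
  then have eq: "q = (\<lambda>x. \<Sum>\<phi>\<in>insert \<psi> \<Phi>. (c(\<psi> := t)) \<phi> * \<phi> x)"
    using assms by (simp add: q)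
  show "q \<in> fun_span (insert \<psi> \<Phi>)" unfolding eq by (rule fun_spanI)
qed

text \<open>The Riesz representation theorem on a finite-dimensional space, for a form that may be degenerate
as long as the functional vanishes on its null vectors. The induction is a Gram--Schmidt step:
the new generator \<open>\<psi>\<close> is replaced by its component \<open>\<psi>'\<close> orthogonal to the previous
span. The subtracted projection is itself a Riesz representative, which is why the induction runs
over all functionals at once. Null vectors cannot be excluded for the energy form, since functions
that vanish almost everywhere have zero energy.\<close>

lemma riesz_representation_fun_span:
  fixes a :: "('x \<Rightarrow> real) \<Rightarrow> ('x \<Rightarrow> real) \<Rightarrow> real" and L :: "('x \<Rightarrow> real) \<Rightarrow> real"
  assumes "finite \<Phi>" "fun_span \<Phi> \<subseteq> V"
    and V: "\<And>p q s t. p \<in> V \<Longrightarrow> q \<in> V \<Longrightarrow> (\<lambda>x. s * p x + t * q x) \<in> V"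
    and lin: "\<And>p q r s t. p \<in> V \<Longrightarrow> q \<in> V \<Longrightarrow> r \<in> V \<Longrightarrow>
      a (\<lambda>x. s * p x + t * q x) r = s * a p r + t * a q r"
    and sym: "\<And>p q. p \<in> V \<Longrightarrow> q \<in> V \<Longrightarrow> a p q = a q p"
    and cs: "\<And>p q. p \<in> V \<Longrightarrow> q \<in> V \<Longrightarrow> (a p q)\<^sup>2 \<le> a p p * a q q"
    and L_lin: "\<And>p q s t. p \<in> V \<Longrightarrow> q \<in> V \<Longrightarrow> L (\<lambda>x. s * p x + t * q x) = s * L p + t * L q"
    and L_null: "\<And>p. p \<in> V \<Longrightarrow> a p p = 0 \<Longrightarrow> L p = 0"
  shows "\<exists>w\<in>fun_span \<Phi>. \<forall>q\<in>fun_span \<Phi>. a w q = L q"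
  using assms(1,2) L_lin L_null
proof (induction \<Phi> arbitrary: L rule: finite_induct)
  case empty
  have "fun_span {} = {\<lambda>x::'x. 0}" by (auto simp: fun_span_def)
  then have z: "(\<lambda>x. 0) \<in> V" "fun_span {} = {\<lambda>x::'x. 0}" using empty by auto
  have "a (\<lambda>x. 0) (\<lambda>x. 0) = 0" "L (\<lambda>x. 0) = 0"
    using lin[OF z(1) z(1) z(1), of 0 0] empty(2)[OF z(1) z(1), of 0 0] by auto
  then show ?case using z by auto
next
  case (insert \<psi> \<Phi>)
  note ins = fun_span_insert[OF insert(1,2)]
  have "(\<lambda>x. 0) \<in> fun_span \<Phi>" by (auto simp: fun_span_def intro!: exI[of _ "\<lambda>_. 0"])
  then have \<psi>: "\<psi> \<in> fun_span (insert \<psi> \<Phi>)"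
    unfolding ins by (intro exI[of _ 1] bexI[of _ "\<lambda>x. 0"]) auto
  have sub: "fun_span \<Phi> \<subseteq> fun_span (insert \<psi> \<Phi>)"
  proof
    fix r :: "'x \<Rightarrow> real" assume "r \<in> fun_span \<Phi>"
    then show "r \<in> fun_span (insert \<psi> \<Phi>)"
      unfolding ins by (intro exI[of _ 0] bexI[of _ r]) auto
  qed
  then have in_V: "\<psi> \<in> V" "\<And>r. r \<in> fun_span \<Phi> \<Longrightarrow> r \<in> V"
    using \<psi> insert.prems(1) by auto
  obtain w\<^sub>0 where w\<^sub>0: "w\<^sub>0 \<in> fun_span \<Phi>" "\<And>q. q \<in> fun_span \<Phi> \<Longrightarrow> a w\<^sub>0 q = L q"
    using insert.IH[of L] insert.prems in_V(2) by blast
  have "\<exists>r\<in>fun_span \<Phi>. \<forall>q\<in>fun_span \<Phi>. a r q = a \<psi> q"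
  proof (rule insert.IH)
    show "fun_span \<Phi> \<subseteq> V" using in_V by blast
    show "a \<psi> (\<lambda>x. s * p x + t * q x) = s * a \<psi> p + t * a \<psi> q" if "p \<in> V" "q \<in> V" for p q s t
      using sym[OF in_V(1) V[OF that, of s t]] lin[OF that in_V(1), of s t]
        sym[OF in_V(1) that(1)] sym[OF in_V(1) that(2)] by simp
    show "a \<psi> p = 0" if "p \<in> V" "a p p = 0" for p
      using cs[OF in_V(1) that(1)] that(2) by simp
  qed
  then obtain r where r: "r \<in> fun_span \<Phi>" "\<And>q. q \<in> fun_span \<Phi> \<Longrightarrow> a r q = a \<psi> q" by blast
  define \<psi>' where "\<psi>' = (\<lambda>x. 1 * \<psi> x + (-1) * r x)"
  have \<psi>'_V: "\<psi>' \<in> V" unfolding \<psi>'_def by (intro V in_V r)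
  have orth: "a \<psi>' q = 0" if "q \<in> fun_span \<Phi>" for q
    unfolding \<psi>'_def using that r by (subst lin) (auto intro: in_V)
  \<comment> \<open>in the degenerate case \<open>\<psi>'\<close> is a null vector of the form and of \<open>L\<close>, so that any coefficient works\<close>
  define c where "c = (if a \<psi>' \<psi>' = 0 then 0 else L \<psi>' / a \<psi>' \<psi>')"
  have c: "c * a \<psi>' \<psi>' = L \<psi>'"
    using insert.prems(3)[OF \<psi>'_V] by (simp add: c_def)
  define w where "w = (\<lambda>x. 1 * w\<^sub>0 x + c * \<psi>' x)"
  have w_V: "w \<in> V" unfolding w_def by (intro V in_V w\<^sub>0 \<psi>'_V)
  have "w = (\<lambda>x. c * \<psi> x + (1 * w\<^sub>0 x + (- c) * r x))"
    by (simp add: w_def \<psi>'_def algebra_simps)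
  then have "w \<in> fun_span (insert \<psi> \<Phi>)"
    unfolding ins by (intro exI[of _ c] bexI[OF _ fun_span_lincomb[OF w\<^sub>0(1) r(1), of 1 "- c"]])
  moreover have "a w q = L q" if q_span: "q \<in> fun_span (insert \<psi> \<Phi>)" for q
  proof -
    obtain t q' where q': "q' \<in> fun_span \<Phi>" "q = (\<lambda>x. t * \<psi> x + q' x)"
      using q_span unfolding ins by blast
    \<comment> \<open>the given element decomposed along \<open>\<psi>'\<close> and the old span\<close>
    define q'' where "q'' = (\<lambda>x. 1 * q' x + t * r x)"
    have q'': "q'' \<in> fun_span \<Phi>" unfolding q''_def by (intro fun_span_lincomb q' r)
    have q: "q = (\<lambda>x. t * \<psi>' x + 1 * q'' x)"
      by (simp add: q'(2) q''_def \<psi>'_def algebra_simps)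
    have w: "a w p = a w\<^sub>0 p + c * a \<psi>' p" if "p \<in> V" for p
      unfolding w_def using lin[OF in_V(2)[OF w\<^sub>0(1)] \<psi>'_V that, of 1 c] by simp
    have "a w \<psi>' = L \<psi>'"
      using w[OF \<psi>'_V] c orth[OF w\<^sub>0(1)] sym[OF \<psi>'_V in_V(2)[OF w\<^sub>0(1)]] by simp
    moreover have "a w q'' = L q''"
      using w[OF in_V(2)[OF q'']] orth[OF q''] w\<^sub>0(2)[OF q''] by simp
    moreover have "a w q = t * a w \<psi>' + 1 * a w q''"
      unfolding q
      using sym[OF w_V V[OF \<psi>'_V in_V(2)[OF q''], of t 1]] lin[OF \<psi>'_V in_V(2)[OF q''] w_V, of t 1]
        sym[OF w_V \<psi>'_V] sym[OF w_V in_V(2)[OF q'']] by simp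
    ultimately show ?thesis
      using insert.prems(2)[OF \<psi>'_V in_V(2)[OF q''], of t 1] by (simp add: q)
  qed
  ultimately show ?case by blast
qed

section \<open>The energy inner product and its dual space\<close>

locale energy_space =
  fixes \<Omega> :: "'a::euclidean_space set" and \<alpha> :: "'a \<Rightarrow> real" and \<alpha>_lo \<alpha>_hi :: real
  assumes open_domain: "open \<Omega>" and bounded_domain: "bounded \<Omega>"
    and alpha_measurable: "\<alpha> \<in> borel_measurable (lebesgue_on \<Omega>)"
    and alpha_lo_pos: "0 < \<alpha>_lo"
    and alpha_bounds: "\<And>x. x \<in> \<Omega> \<Longrightarrow> \<alpha>_lo \<le> \<alpha> x \<and> \<alpha> x \<le> \<alpha>_hi"
begin

lemma alpha_pos: "x \<in> \<Omega> \<Longrightarrow> 0 < \<alpha> x"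
  using alpha_bounds alpha_lo_pos by (meson less_le_trans)

lemma alpha_times_L2:
  fixes f :: "'a \<Rightarrow> 'b::euclidean_space"
  assumes "f \<in> L2_on \<Omega>"
  shows "(\<lambda>x. \<alpha> x *\<^sub>R f x) \<in> L2_on \<Omega>"
proof -
  have m: "(\<lambda>x. \<alpha> x *\<^sub>R f x) \<in> borel_measurable (lebesgue_on \<Omega>)"
    using alpha_measurable L2_on_measurable[OF assms] by measurable
  have "integrable (lebesgue_on \<Omega>) (\<lambda>x. (norm (\<alpha> x *\<^sub>R f x))\<^sup>2)"
  proof (rule Bochner_Integration.integrable_bound)
    show "integrable (lebesgue_on \<Omega>) (\<lambda>x. \<alpha>_hi\<^sup>2 * (norm (f x))\<^sup>2)"
      using L2_on_integrable[OF assms] by simp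
    show "AE x in lebesgue_on \<Omega>. norm ((norm (\<alpha> x *\<^sub>R f x))\<^sup>2) \<le> norm (\<alpha>_hi\<^sup>2 * (norm (f x))\<^sup>2)"
    proof (rule AE_I2)
      fix x assume "x \<in> space (lebesgue_on \<Omega>)"
      then have "x \<in> \<Omega>" by simp
      then have "(\<alpha> x)\<^sup>2 \<le> \<alpha>_hi\<^sup>2"
        using alpha_pos alpha_bounds by (intro power_mono) (auto intro: less_imp_le)
      then show "norm ((norm (\<alpha> x *\<^sub>R f x))\<^sup>2) \<le> norm (\<alpha>_hi\<^sup>2 * (norm (f x))\<^sup>2)"
        by (simp add: power_mult_distrib mult_right_mono)
    qed
  qed (use m in measurable)
  with m show ?thesis by (simp add: L2_on_def)
qed

lemma diffusion_integrable:
  assumes "p \<in> H1 \<Omega>" "q \<in> H1 \<Omega>"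
  shows "integrable (lebesgue_on \<Omega>) (\<lambda>x. \<alpha> x * (weak_grad \<Omega> p x \<bullet> weak_grad \<Omega> q x))"
  using L2_on_inner_integrable[OF alpha_times_L2 H1_weak_grad_L2, OF H1_weak_grad_L2,
      OF open_domain assms(1) open_domain assms(2)] by simp

lemma diffusion_sym: "diffusion_form \<Omega> \<alpha> p q = diffusion_form \<Omega> \<alpha> q p"
  by (simp add: diffusion_form_def inner_commute)

lemma diffusion_nonneg: "0 \<le> diffusion_form \<Omega> \<alpha> p p"
  unfolding diffusion_form_def
  by (intro integral_nonneg_AE AE_I2) (simp add: alpha_pos less_imp_le)

lemma Y_norm_eq: "Y_norm \<Omega> \<alpha> p = sqrt (diffusion_form \<Omega> \<alpha> p p)"
  by (simp add: Y_norm_def diffusion_form_def power2_norm_eq_inner)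

lemma Y_norm_nonneg: "0 \<le> Y_norm \<Omega> \<alpha> p"
  by (simp add: Y_norm_eq diffusion_nonneg)

lemma Y_norm_squared: "(Y_norm \<Omega> \<alpha> p)\<^sup>2 = diffusion_form \<Omega> \<alpha> p p"
  by (simp add: Y_norm_eq diffusion_nonneg)

lemma diffusion_lincomb:
  assumes "p \<in> H1 \<Omega>" "q \<in> H1 \<Omega>" "r \<in> H1 \<Omega>"
  shows "diffusion_form \<Omega> \<alpha> (\<lambda>x. s * p x + t * q x) r
     = s * diffusion_form \<Omega> \<alpha> p r + t * diffusion_form \<Omega> \<alpha> q r"
proof -
  let ?d = "\<lambda>p x. \<alpha> x * (weak_grad \<Omega> p x \<bullet> weak_grad \<Omega> r x)"
  note i = diffusion_integrable[OF assms(1,3)] diffusion_integrable[OF assms(2,3)]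
    diffusion_integrable[OF H1_lincomb[OF open_domain assms(1,2)] assms(3), of s t]
  have "diffusion_form \<Omega> \<alpha> (\<lambda>x. s * p x + t * q x) r = (LINT x|lebesgue_on \<Omega>. s * ?d p x + t * ?d q x)"
    unfolding diffusion_form_def
  proof (rule integral_cong_AE)
    show "AE x in lebesgue_on \<Omega>. ?d (\<lambda>x. s * p x + t * q x) x = s * ?d p x + t * ?d q x"
      using weak_grad_lincomb[OF open_domain assms(1,2), of s t]
      by eventually_elim (simp add: inner_add_left algebra_simps)
  qed (use i in \<open>auto intro!: borel_measurable_integrable\<close>)
  also have "\<dots> = s * diffusion_form \<Omega> \<alpha> p r + t * diffusion_form \<Omega> \<alpha> q r"
    unfolding diffusion_form_def using i by (subst Bochner_Integration.integral_add) auto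
  finally show ?thesis .
qed

lemma diffusion_cauchy_schwarz:
  assumes "p \<in> H1 \<Omega>" "q \<in> H1 \<Omega>"
  shows "(diffusion_form \<Omega> \<alpha> p q)\<^sup>2 \<le> diffusion_form \<Omega> \<alpha> p p * diffusion_form \<Omega> \<alpha> q q"
proof (rule Cauchy_Schwarz_from_quadratic)
  fix t :: real
  let ?r = "\<lambda>x. 1 * p x + t * q x"
  have r: "?r \<in> H1 \<Omega>" by (intro H1_lincomb open_domain assms)
  have "diffusion_form \<Omega> \<alpha> ?r ?r = diffusion_form \<Omega> \<alpha> ?r p + t * diffusion_form \<Omega> \<alpha> ?r q"
    using diffusion_lincomb[OF assms r, of 1 t] diffusion_sym by simp
  also have "\<dots> = diffusion_form \<Omega> \<alpha> p p + 2 * t * diffusion_form \<Omega> \<alpha> p q + t\<^sup>2 * diffusion_form \<Omega> \<alpha> q q"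
    using diffusion_lincomb[OF assms assms(1), of 1 t] diffusion_lincomb[OF assms assms(2), of 1 t]
      diffusion_sym[of q p] by (simp add: power2_eq_square algebra_simps)
  finally show "0 \<le> diffusion_form \<Omega> \<alpha> p p + 2 * t * diffusion_form \<Omega> \<alpha> p q + t\<^sup>2 * diffusion_form \<Omega> \<alpha> q q"
    using diffusion_nonneg[of ?r] by simp
qed (rule diffusion_nonneg)

lemma diffusion_le_Y_norm:
  assumes "p \<in> H1 \<Omega>" "q \<in> H1 \<Omega>"
  shows "diffusion_form \<Omega> \<alpha> p q \<le> Y_norm \<Omega> \<alpha> p * Y_norm \<Omega> \<alpha> q"
proof -
  have "(diffusion_form \<Omega> \<alpha> p q)\<^sup>2 \<le> (Y_norm \<Omega> \<alpha> p * Y_norm \<Omega> \<alpha> q)\<^sup>2"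
    using diffusion_cauchy_schwarz[OF assms] by (simp add: power_mult_distrib Y_norm_squared)
  then show ?thesis
    by (rule power2_le_imp_le) (simp add: Y_norm_nonneg)
qed

text \<open>The energy norm is continuous with respect to the Sobolev norm, so that the density of test
functions carries over to functionals bounded in the energy norm. The absolute value covers the
degenerate case of an empty domain, where nothing is known about the sign of \<open>\<alpha>_hi\<close>.\<close>

lemma Y_norm_le_H1_norm:
  assumes "p \<in> H1 \<Omega>"
  shows "Y_norm \<Omega> \<alpha> p \<le> sqrt \<bar>\<alpha>_hi\<bar> * H1_norm \<Omega> p"
proof (rule power2_le_imp_le)
  have i: "integrable (lebesgue_on \<Omega>) (\<lambda>x. (norm (weak_grad \<Omega> p x))\<^sup>2)"
    by (intro L2_on_integrable H1_weak_grad_L2 open_domain assms)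
  have "(Y_norm \<Omega> \<alpha> p)\<^sup>2 \<le> (LINT x|lebesgue_on \<Omega>. \<bar>\<alpha>_hi\<bar> * (norm (weak_grad \<Omega> p x))\<^sup>2)"
    unfolding Y_norm_squared diffusion_form_def power2_norm_eq_inner[symmetric]
  proof (rule integral_mono)
    show "integrable (lebesgue_on \<Omega>) (\<lambda>x. \<alpha> x * (norm (weak_grad \<Omega> p x))\<^sup>2)"
      using diffusion_integrable[OF assms assms] by (simp add: power2_norm_eq_inner)
    show "\<alpha> x * (norm (weak_grad \<Omega> p x))\<^sup>2 \<le> \<bar>\<alpha>_hi\<bar> * (norm (weak_grad \<Omega> p x))\<^sup>2"
      if "x \<in> space (lebesgue_on \<Omega>)" for x
      using alpha_bounds[of x] that by (intro mult_right_mono) auto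
  qed (use i in auto)
  also have "\<dots> = \<bar>\<alpha>_hi\<bar> * (LINT x|lebesgue_on \<Omega>. (norm (weak_grad \<Omega> p x))\<^sup>2)" by simp
  also have "\<dots> \<le> \<bar>\<alpha>_hi\<bar> * (H1_norm \<Omega> p)\<^sup>2"
    unfolding H1_norm_squared by (intro mult_left_mono) (auto intro!: integral_nonneg)
  finally show "(Y_norm \<Omega> \<alpha> p)\<^sup>2 \<le> (sqrt \<bar>\<alpha>_hi\<bar> * H1_norm \<Omega> p)\<^sup>2"
    by (simp add: power_mult_distrib)
qed (simp add: H1_norm_nonneg)

text \<open>The coefficient is positive, so vanishing energy forces the weak gradient to vanish almost
everywhere, and the Poincare inequality does the rest.\<close>

lemma diffusion_definite:
  assumes "p \<in> H10 \<Omega>" "diffusion_form \<Omega> \<alpha> p p = 0"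
  shows "AE x in lebesgue_on \<Omega>. p x = 0"
proof (rule H10_zero_grad_imp_zero[OF open_domain bounded_domain assms(1)])
  have "AE x in lebesgue_on \<Omega>. 0 \<le> \<alpha> x * (weak_grad \<Omega> p x \<bullet> weak_grad \<Omega> p x)"
    by (intro AE_I2) (simp add: alpha_pos less_imp_le)
  then have "AE x in lebesgue_on \<Omega>. \<alpha> x * (weak_grad \<Omega> p x \<bullet> weak_grad \<Omega> p x) = 0"
    using integral_nonneg_eq_0_iff_AE[OF diffusion_integrable[OF assms(1)[THEN H10_H1] assms(1)[THEN H10_H1]]]
      assms(2) by (simp add: diffusion_form_def)
  moreover have "AE x in lebesgue_on \<Omega>. \<alpha> x \<noteq> 0"
    using alpha_pos by (intro AE_I2) fastforce
  ultimately show "AE x in lebesgue_on \<Omega>. weak_grad \<Omega> p x = 0"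
    by eventually_elim simp
qed

lemma Y_dual_lincomb:
  assumes "F \<in> Y_dual \<Omega> \<alpha>" "p \<in> H10 \<Omega>" "q \<in> H10 \<Omega>"
  shows "F (\<lambda>x. s * p x + t * q x) = s * F p + t * F q"
  using assms H10_scale[OF open_domain assms(2), of s] H10_scale[OF open_domain assms(3), of t]
  by (simp add: Y_dual_def)

lemma Y_dual_boundE:
  assumes "F \<in> Y_dual \<Omega> \<alpha>"
  obtains C where "C \<ge> 0" "\<And>q. q \<in> H10 \<Omega> \<Longrightarrow> \<bar>F q\<bar> \<le> C * Y_norm \<Omega> \<alpha> q"
proof -
  obtain C where C: "\<forall>q\<in>H10 \<Omega>. \<bar>F q\<bar> \<le> C * Y_norm \<Omega> \<alpha> q"
    using assms unfolding Y_dual_def by blast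
  have "\<bar>F q\<bar> \<le> \<bar>C\<bar> * Y_norm \<Omega> \<alpha> q" if "q \<in> H10 \<Omega>" for q
    using bspec[OF C that] mult_right_mono[OF abs_ge_self Y_norm_nonneg, of C q] by linarith
  then show thesis by (intro that[of "\<bar>C\<bar>"]) auto
qed

lemma Y_dual_diff:
  assumes "F \<in> Y_dual \<Omega> \<alpha>" "G \<in> Y_dual \<Omega> \<alpha>"
  shows "(\<lambda>q\<in>H10 \<Omega>. F q - G q) \<in> Y_dual \<Omega> \<alpha>"
proof -
  let ?D = "\<lambda>q\<in>H10 \<Omega>. F q - G q"
  obtain B where B: "B \<ge> 0" "\<And>q. q \<in> H10 \<Omega> \<Longrightarrow> \<bar>F q\<bar> \<le> B * Y_norm \<Omega> \<alpha> q"
    using Y_dual_boundE[OF assms(1)] by blast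
  obtain C where C: "C \<ge> 0" "\<And>q. q \<in> H10 \<Omega> \<Longrightarrow> \<bar>G q\<bar> \<le> C * Y_norm \<Omega> \<alpha> q"
    using Y_dual_boundE[OF assms(2)] by blast
  have lin: "?D (\<lambda>x. s * p x + t * q x) = s * ?D p + t * ?D q"
    if "p \<in> H10 \<Omega>" "q \<in> H10 \<Omega>" for p q s t
    using that assms H10_lincomb[OF open_domain that, of s t] by (simp add: Y_dual_lincomb algebra_simps)
  have "\<bar>?D q\<bar> \<le> (B + C) * Y_norm \<Omega> \<alpha> q" if "q \<in> H10 \<Omega>" for q
    using B(2)[OF that] C(2)[OF that] that by (simp add: algebra_simps)
  moreover have "?D (\<lambda>x. p x + q x) = ?D p + ?D q" if "p \<in> H10 \<Omega>" "q \<in> H10 \<Omega>" for p q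
    using lin[OF that, of 1 1] by simp
  moreover have "?D (\<lambda>x. c * p x) = c * ?D p" if "p \<in> H10 \<Omega>" for p c
    using lin[OF that that, of c 0] by simp
  ultimately show ?thesis unfolding Y_dual_def by blast
qed

text \<open>Both functionals are continuous in the energy norm and test functions are dense in
\<open>H10 \<Omega>\<close>. This makes the unique description in \<^const>\<open>duality_pairing\<close> meaningful.\<close>

lemma Y_dual_eqI:
  assumes "F \<in> Y_dual \<Omega> \<alpha>" "G \<in> Y_dual \<Omega> \<alpha>" and eq: "\<And>\<phi>. \<phi> \<in> test_funs \<Omega> \<Longrightarrow> F \<phi> = G \<phi>"
  shows "F = G"
proof (rule extensionalityI[of _ "H10 \<Omega>"])
  show "F \<in> extensional (H10 \<Omega>)" "G \<in> extensional (H10 \<Omega>)"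
    using assms by (auto simp: Y_dual_def)
  fix q assume q: "q \<in> H10 \<Omega>"
  obtain C where C: "C \<ge> 0"
    "\<And>p. p \<in> H10 \<Omega> \<Longrightarrow> \<bar>(\<lambda>q\<in>H10 \<Omega>. F q - G q) p\<bar> \<le> C * Y_norm \<Omega> \<alpha> p"
    using Y_dual_boundE[OF Y_dual_diff[OF assms(1,2)]] by blast
  define M where "M = C * sqrt \<bar>\<alpha>_hi\<bar>"
  have "M \<ge> 0" using C by (simp add: M_def)
  have "\<bar>F q - G q\<bar> \<le> M * \<epsilon>" if \<epsilon>: "\<epsilon> > 0" for \<epsilon>
  proof -
    obtain \<phi> where \<phi>: "\<phi> \<in> test_funs \<Omega>" "H1_norm \<Omega> (\<lambda>x. 1 * q x + (-1) * \<phi> x) < \<epsilon>"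
      using H10_approx[OF q \<epsilon>] by metis
    define d where "d = (\<lambda>x. 1 * q x + (-1) * \<phi> x)"
    note \<phi>_H10 = test_funs_H10[OF open_domain \<phi>(1)]
    have d: "d \<in> H10 \<Omega>" unfolding d_def by (intro H10_lincomb open_domain q \<phi>_H10)
    have "F q - G q = F d - G d"
      unfolding d_def Y_dual_lincomb[OF assms(1) q \<phi>_H10] Y_dual_lincomb[OF assms(2) q \<phi>_H10]
      using eq[OF \<phi>(1)] by simp
    then have "\<bar>F q - G q\<bar> \<le> C * Y_norm \<Omega> \<alpha> d"
      using C(2)[OF d] d by simp
    also have "\<dots> \<le> C * (sqrt \<bar>\<alpha>_hi\<bar> * \<epsilon>)"
      using Y_norm_le_H1_norm[OF H10_H1[OF d]] \<phi>(2) C(1)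
      by (intro mult_left_mono order_trans[OF Y_norm_le_H1_norm[OF H10_H1[OF d]]])
        (auto simp: d_def)
    finally show ?thesis by (simp add: M_def mult.assoc)
  qed
  then have "\<bar>F q - G q\<bar> \<le> 0 + \<delta>" if "\<delta> > 0" for \<delta>
  proof -
    assume *: "\<And>\<epsilon>. 0 < \<epsilon> \<Longrightarrow> \<bar>F q - G q\<bar> \<le> M * \<epsilon>"
    have "\<bar>F q - G q\<bar> \<le> M * (\<delta> / (M + 1))" using that \<open>M \<ge> 0\<close> by (intro *) simp
    also have "\<dots> \<le> \<delta>" using that \<open>M \<ge> 0\<close> by (simp add: field_simps)
    finally show ?thesis by simp
  qed
  then have "\<bar>F q - G q\<bar> \<le> 0" by (rule field_le_epsilon)
  then show "F q = G q" by simp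
qed

lemma duality_pairing_eq:
  assumes "F \<in> Y_dual \<Omega> \<alpha>" "represents \<Omega> g F"
  shows "duality_pairing \<Omega> \<alpha> g q = F q"
proof -
  have "(THE F. F \<in> Y_dual \<Omega> \<alpha> \<and> represents \<Omega> g F) = F"
    using assms by (intro the_equality) (auto intro!: Y_dual_eqI simp: represents_def)
  then show ?thesis by (simp add: duality_pairing_def)
qed

end

lemma locally_integrable_cong_AE:
  fixes f g :: "'a::euclidean_space \<Rightarrow> 'b::euclidean_space"
  assumes "open \<Omega>" "locally_integrable \<Omega> f" and ae: "AE x in lebesgue_on \<Omega>. f x = g x"
  shows "locally_integrable \<Omega> g"
  unfolding locally_integrable_def
proof safe
  fix K :: "'a set" assume K: "compact K" "K \<subseteq> \<Omega>"
  have \<Omega>: "\<Omega> \<inter> space lebesgue \<in> sets lebesgue" using \<open>open \<Omega>\<close> by auto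
  have f: "integrable lebesgue (\<lambda>x. indicator K x *\<^sub>R f x)"
    using assms(2) K by (simp add: locally_integrable_def set_integrable_def)
  have eq: "AE x in lebesgue. indicator K x *\<^sub>R f x = indicator K x *\<^sub>R g x"
    using ae unfolding AE_restrict_space_iff[OF \<Omega>]
    by eventually_elim (use K(2) in \<open>auto simp: indicator_def\<close>)
  have "(\<lambda>x. indicator K x *\<^sub>R g x) \<in> borel_measurable lebesgue"
    using borel_measurable_integrable[OF f] eq by (rule borel_measurable_AE)
  with f show "g absolutely_integrable_on K"
    unfolding set_integrable_def using eq by (rule integrable_cong_AE_imp)
qed

lemma represents_cong_AE:
  assumes "open \<Omega>" "represents \<Omega> g F" and ae: "AE x in lebesgue_on \<Omega>. g x = g' x"
  shows "represents \<Omega> g' F"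
proof -
  have l: "locally_integrable \<Omega> g" "locally_integrable \<Omega> g'"
    using assms locally_integrable_cong_AE by (auto simp: represents_def)
  have "(LINT x|lebesgue_on \<Omega>. g x * \<phi> x) = (LINT x|lebesgue_on \<Omega>. g' x * \<phi> x)"
    if "\<phi> \<in> test_funs \<Omega>" for \<phi>
  proof (rule integral_cong_AE)
    show "AE x in lebesgue_on \<Omega>. g x * \<phi> x = g' x * \<phi> x"
      using ae by eventually_elim simp
  qed (use l[THEN integrable_test_scaleR[OF assms(1) _ that], THEN borel_measurable_integrable]
      in \<open>simp_all add: mult.commute\<close>)
  then show ?thesis using assms(2) l(2) by (simp add: represents_def)
qed

context energy_space
begin

section \<open>The convection form and discrete Riesz representatives\<close>

lemma convection_eqI:
  assumes "F \<in> Y_dual \<Omega> \<alpha>" "represents \<Omega> (\<lambda>x. v x \<bullet> weak_grad \<Omega> u x) F"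
  shows "convection_form \<Omega> \<alpha> v u q = F q"
  unfolding convection_form_def by (rule duality_pairing_eq[OF assms])

text \<open>The difference of the two representing functionals represents
$v \cdot \nabla u - v \cdot \nabla w$, which agrees almost everywhere with
$v \cdot \nabla (u - w)$. The functional is exhibited because the discrete Riesz representative
of $v \cdot \nabla (u - w)$ exists by its linearity and boundedness.\<close>

lemma X_space_convection_diff:
  assumes "u \<in> X_space \<Omega> \<alpha> v" "w \<in> X_space \<Omega> \<alpha> v"
  obtains F where "F \<in> Y_dual \<Omega> \<alpha>"
    "\<And>q. convection_form \<Omega> \<alpha> v (\<lambda>x. u x - w x) q = F q"
    "\<And>q. q \<in> H10 \<Omega> \<Longrightarrow> F q = convection_form \<Omega> \<alpha> v u q - convection_form \<Omega> \<alpha> v w q"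
proof -
  let ?c = "\<lambda>u x. v x \<bullet> weak_grad \<Omega> u x"
  obtain F\<^sub>u where Fu: "F\<^sub>u \<in> Y_dual \<Omega> \<alpha>" "represents \<Omega> (?c u) F\<^sub>u"
    using assms(1) by (auto simp: X_space_def)
  obtain F\<^sub>w where Fw: "F\<^sub>w \<in> Y_dual \<Omega> \<alpha>" "represents \<Omega> (?c w) F\<^sub>w"
    using assms(2) by (auto simp: X_space_def)
  have H1: "u \<in> H1 \<Omega>" "w \<in> H1 \<Omega>"
    using assms by (auto simp: X_space_def H10_H1)
  define F where "F = (\<lambda>q\<in>H10 \<Omega>. F\<^sub>u q - F\<^sub>w q)"
  have F: "F \<in> Y_dual \<Omega> \<alpha>" unfolding F_def by (rule Y_dual_diff[OF Fu(1) Fw(1)])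
  have loc: "locally_integrable \<Omega> (?c u)" "locally_integrable \<Omega> (?c w)"
    using Fu Fw by (auto simp: represents_def)
  have "represents \<Omega> (\<lambda>x. ?c u x - ?c w x) F"
    unfolding represents_def
  proof (intro conjI ballI)
    show "locally_integrable \<Omega> (\<lambda>x. ?c u x - ?c w x)"
      using locally_integrable_lincomb[OF loc, of 1 "-1"] by simp
    fix \<phi> assume \<phi>: "\<phi> \<in> test_funs \<Omega>"
    have i: "integrable (lebesgue_on \<Omega>) (\<lambda>x. ?c u x * \<phi> x)" "integrable (lebesgue_on \<Omega>) (\<lambda>x. ?c w x * \<phi> x)"
      using loc[THEN integrable_test_scaleR[OF open_domain _ \<phi>]] by (simp_all add: mult.commute)
    have "F \<phi> = (LINT x|lebesgue_on \<Omega>. ?c u x * \<phi> x) - (LINT x|lebesgue_on \<Omega>. ?c w x * \<phi> x)"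
      using Fu(2) Fw(2) \<phi> test_funs_H10[OF open_domain \<phi>] by (simp add: F_def represents_def)
    also have "\<dots> = (LINT x|lebesgue_on \<Omega>. (?c u x - ?c w x) * \<phi> x)"
      using Bochner_Integration.integral_diff[OF i] by (simp add: left_diff_distrib)
    finally show "F \<phi> = (LINT x|lebesgue_on \<Omega>. (?c u x - ?c w x) * \<phi> x)" .
  qed
  moreover have "AE x in lebesgue_on \<Omega>. ?c u x - ?c w x = ?c (\<lambda>x. u x - w x) x"
  proof -
    have "AE x in lebesgue_on \<Omega>. weak_grad \<Omega> (\<lambda>x. u x - w x) x = weak_grad \<Omega> u x - weak_grad \<Omega> w x"
      using weak_grad_lincomb[OF open_domain H1, of 1 "-1"] by simp
    then show ?thesis by eventually_elim (simp add: inner_diff_right)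
  qed
  ultimately have "represents \<Omega> (?c (\<lambda>x. u x - w x)) F"
    by (rule represents_cong_AE[OF open_domain])
  then show thesis
    using convection_eqI[OF F] convection_eqI[OF Fu] convection_eqI[OF Fw]
    by (intro that[OF F]) (auto simp: F_def)
qed

text \<open>Functions in \<^const>\<open>pw_linear\<close> are continuous on the closure of the domain and fixed outside
of it. The set of points in \<open>\<Omega>\<close> where they differ is open, and a nonempty open set is not
negligible.\<close>

lemma pw_linear_eq_if_AE_eq:
  assumes "p \<in> pw_linear \<Omega> \<T>" "q \<in> pw_linear \<Omega> \<T>" and ae: "AE x in lebesgue_on \<Omega>. p x = q x"
  shows "p = q"
proof -
  define d where "d x = p x - q x" for x
  have cont: "continuous_on (closure \<Omega>) d"
    unfolding d_def using assms by (auto simp: pw_linear_def intro!: continuous_intros)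
  have \<Omega>: "\<Omega> \<inter> space lebesgue \<in> sets lebesgue" using open_domain by auto
  define U where "U = {x \<in> \<Omega>. d x \<noteq> 0}"
  have "U = \<Omega> \<inter> d -` (- {0})" by (auto simp: U_def)
  then have "open U"
    using continuous_open_preimage[OF continuous_on_subset[OF cont closure_subset] open_domain, of "- {0}"]
    by (simp add: open_Compl)
  have "AE x in lebesgue. x \<notin> U"
    using ae unfolding AE_restrict_space_iff[OF \<Omega>]
    by eventually_elim (auto simp: U_def d_def)
  then have "negligible U"
    using \<open>open U\<close> by (simp add: negligible_iff_null_sets AE_iff_null_sets)
  then have "U = {}" using \<open>open U\<close> open_not_negligible by blast
  then have "\<Omega> \<subseteq> {x \<in> closure \<Omega>. d x = 0}" using closure_subset by (auto simp: U_def)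
  then have "closure \<Omega> \<subseteq> {x \<in> closure \<Omega>. d x = 0}"
    by (rule closure_minimal) (rule continuous_closed_preimage_constant[OF cont closed_closure])
  moreover have "d x = 0" if "x \<notin> closure \<Omega>" for x
    using that assms by (simp add: d_def pw_linear_def)
  ultimately have "d x = 0" for x by blast
  then show ?thesis by (auto simp: d_def)
qed

text \<open>The defining property of \<^const>\<open>w_sol\<close>. Existence is the Riesz representation theorem;
boundedness of \<open>F\<close> in the energy norm ensures that it vanishes on null vectors. Two solutions
differ by a function of zero energy, which is zero almost everywhere and hence everywhere.\<close>

lemma w_sol_characterization:
  assumes fe: "conforming_fe_space \<Omega> \<T> (H10 \<Omega>) Yh"
    and F: "F \<in> Y_dual \<Omega> \<alpha>" "\<And>q. convection_form \<Omega> \<alpha> v e q = F q"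
  shows "w_sol \<Omega> \<alpha> v Yh e \<in> Yh"
    and "\<And>q. q \<in> Yh \<Longrightarrow> diffusion_form \<Omega> \<alpha> (w_sol \<Omega> \<alpha> v Yh e) q = convection_form \<Omega> \<alpha> v e q"
proof -
  let ?P = "\<lambda>w. w \<in> Yh \<and> (\<forall>q\<in>Yh. diffusion_form \<Omega> \<alpha> w q = convection_form \<Omega> \<alpha> v e q)"
  obtain \<Phi> where \<Phi>: "finite \<Phi>" "Yh = fun_span \<Phi>"
    using fe by (auto simp: conforming_fe_space_def fun_span_def)
  have Yh: "Yh \<subseteq> H10 \<Omega>" "Yh \<subseteq> pw_linear \<Omega> \<T>"
    using fe by (auto simp: conforming_fe_space_def)
  have null: "F p = 0" if p: "p \<in> H10 \<Omega>" "diffusion_form \<Omega> \<alpha> p p = 0" for p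
  proof -
    obtain C where "\<bar>F p\<bar> \<le> C * Y_norm \<Omega> \<alpha> p"
      using Y_dual_boundE[OF F(1)] p(1) by metis
    then show ?thesis using p(2) by (simp add: Y_norm_eq)
  qed
  have "\<exists>w\<in>fun_span \<Phi>. \<forall>q\<in>fun_span \<Phi>. diffusion_form \<Omega> \<alpha> w q = F q"
    using \<Phi> Yh null
    by (intro riesz_representation_fun_span[where V = "H10 \<Omega>"])
      (auto intro: H10_lincomb open_domain diffusion_lincomb diffusion_sym diffusion_cauchy_schwarz
        H10_H1 Y_dual_lincomb[OF F(1)])
  then obtain w where w: "?P w" using \<Phi>(2) F(2) by auto
  have "w' = w" if w': "?P w'" for w'
  proof -
    let ?d = "\<lambda>x. 1 * w' x + (-1) * w x"
    have H: "w \<in> H10 \<Omega>" "w' \<in> H10 \<Omega>" using w w' Yh by auto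
    have d: "?d \<in> Yh" unfolding \<Phi>(2) using w w' \<Phi>(2) by (intro fun_span_lincomb) auto
    then have "diffusion_form \<Omega> \<alpha> ?d ?d = 0"
      using diffusion_lincomb[OF H(2)[THEN H10_H1] H(1)[THEN H10_H1] H10_H1, of ?d 1 "-1"] w w' Yh
      by auto
    then have "AE x in lebesgue_on \<Omega>. ?d x = 0"
      using d Yh by (intro diffusion_definite) auto
    then have "AE x in lebesgue_on \<Omega>. w' x = w x" by eventually_elim simp
    then show "w' = w" using w w' Yh by (intro pw_linear_eq_if_AE_eq) auto
  qed
  then have "?P (w_sol \<Omega> \<alpha> v Yh e)"
    unfolding w_sol_def using w by (intro theI[of ?P w])
  then show "w_sol \<Omega> \<alpha> v Yh e \<in> Yh"
    and "\<And>q. q \<in> Yh \<Longrightarrow> diffusion_form \<Omega> \<alpha> (w_sol \<Omega> \<alpha> v Yh e) q = convection_form \<Omega> \<alpha> v e q"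
    by auto
qed

end

section \<open>The residual bounds the discrete error from below\<close>

theorem lemma2p8:
  fixes \<Omega> :: "(real ^ 'n::finite) set"
    and \<alpha> :: "real ^ 'n \<Rightarrow> real" and \<alpha>_lo \<alpha>_hi :: real
    and v :: "real ^ 'n \<Rightarrow> real ^ 'n" and div_v :: "real ^ 'n \<Rightarrow> real"
    and \<T>H \<T>h :: "(real ^ 'n) set set" and \<sigma> :: real
    and XH Yh :: "(real ^ 'n \<Rightarrow> real) set"
    and f :: "(real ^ 'n \<Rightarrow> real) \<Rightarrow> real"
    and u ph uH :: "real ^ 'n \<Rightarrow> real"
  assumes dim: "CARD('n) \<in> {1, 2, 3}"
    and dom: "bounded \<Omega>" "lipschitz_domain \<Omega>"
    and alpha: "\<alpha> \<in> borel_measurable (lebesgue_on \<Omega>)" "0 < \<alpha>_lo"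
      "\<And>x. x \<in> \<Omega> \<Longrightarrow> \<alpha>_lo \<le> \<alpha> x \<and> \<alpha> x \<le> \<alpha>_hi"
    and vel: "locally_integrable \<Omega> v" "has_weak_div \<Omega> v div_v"
      "AE x in lebesgue_on \<Omega>. div_v x \<le> 0"
    and bij: "B_bijective \<Omega> \<alpha> v"
    and meshH: "admissible_decomposition \<Omega> \<T>H" "shape_regular \<sigma> \<T>H"
    and meshh: "admissible_decomposition \<Omega> \<T>h" "refines \<T>h \<T>H"
    and feH: "conforming_fe_space \<Omega> \<T>H (X_space \<Omega> \<alpha> v) XH"
    and feh: "conforming_fe_space \<Omega> \<T>h (H10 \<Omega>) Yh"
    and sub: "XH \<subseteq> Yh" "XH \<noteq> Yh"
    and f: "f \<in> Y_dual \<Omega> \<alpha>"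
    and u: "u \<in> X_space \<Omega> \<alpha> v" "\<And>q. q \<in> H10 \<Omega> \<Longrightarrow> b_form \<Omega> \<alpha> v u q = f q"
    and mem: "ph \<in> Yh" "uH \<in> XH"
    and eq1: "\<And>qh. qh \<in> Yh \<Longrightarrow> diffusion_form \<Omega> \<alpha> ph qh + b_form \<Omega> \<alpha> v uH qh = f qh"
    and eq2: "\<And>zH. zH \<in> XH \<Longrightarrow> b_form \<Omega> \<alpha> v zH ph = 0"
  shows "1 / sqrt 2 * Y_norm \<Omega> \<alpha> ph \<le> X_h_norm \<Omega> \<alpha> v Yh (\<lambda>x. u x - uH x)"
proof -
  interpret energy_space \<Omega> \<alpha> \<alpha>_lo \<alpha>_hi
    using dom alpha by unfold_locales (auto simp: lipschitz_domain_def)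
  define e where "e = (\<lambda>x. u x - uH x)"
  define w where "w = w_sol \<Omega> \<alpha> v Yh e"
  have uH: "uH \<in> X_space \<Omega> \<alpha> v"
    using feH mem(2) by (auto simp: conforming_fe_space_def)
  have Yh: "Yh \<subseteq> H10 \<Omega>"
    using feh by (auto simp: conforming_fe_space_def)
  have H1: "u \<in> H1 \<Omega>" "uH \<in> H1 \<Omega>" "ph \<in> H1 \<Omega>"
    using u(1) uH mem(1) Yh by (auto simp: X_space_def H10_H1)
  have e_H1: "e \<in> H1 \<Omega>"
    using H1_lincomb[OF open_domain H1(1,2), of 1 "-1"] by (simp add: e_def)
  obtain F where F: "F \<in> Y_dual \<Omega> \<alpha>" "\<And>q. convection_form \<Omega> \<alpha> v e q = F q"
    "\<And>q. q \<in> H10 \<Omega> \<Longrightarrow> F q = convection_form \<Omega> \<alpha> v u q - convection_form \<Omega> \<alpha> v uH q"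
    by (rule X_space_convection_diff[OF u(1) uH, folded e_def]) (rule that)
  have w: "w \<in> Yh" "diffusion_form \<Omega> \<alpha> w ph = convection_form \<Omega> \<alpha> v e ph"
    unfolding w_def using w_sol_characterization[OF feh F(1,2)] mem(1) by auto
  have ph: "ph \<in> H10 \<Omega>" using mem(1) Yh by auto
  have "diffusion_form \<Omega> \<alpha> ph ph = b_form \<Omega> \<alpha> v u ph - b_form \<Omega> \<alpha> v uH ph"
    using eq1[OF mem(1)] u(2)[OF ph] by simp
  also have "\<dots> = diffusion_form \<Omega> \<alpha> e ph + diffusion_form \<Omega> \<alpha> w ph"
    using diffusion_lincomb[OF H1, of 1 "-1"] w(2) F(2) F(3)[OF ph] by (simp add: b_form_def e_def)
  also have "\<dots> \<le> Y_norm \<Omega> \<alpha> e * Y_norm \<Omega> \<alpha> ph + Y_norm \<Omega> \<alpha> w * Y_norm \<Omega> \<alpha> ph"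
    using w(1) Yh by (intro add_mono diffusion_le_Y_norm e_H1 H1 H10_H1) auto
  finally have "(Y_norm \<Omega> \<alpha> ph)\<^sup>2 \<le> (Y_norm \<Omega> \<alpha> e + Y_norm \<Omega> \<alpha> w) * Y_norm \<Omega> \<alpha> ph"
    by (simp add: Y_norm_squared distrib_right)
  then have "Y_norm \<Omega> \<alpha> ph \<le> Y_norm \<Omega> \<alpha> e + Y_norm \<Omega> \<alpha> w"
    using Y_norm_nonneg[of ph] Y_norm_nonneg[of e] Y_norm_nonneg[of w]
    by (cases "Y_norm \<Omega> \<alpha> ph = 0") (auto simp: power2_eq_square)
  also have "\<dots> \<le> sqrt 2 * X_h_norm \<Omega> \<alpha> v Yh e"
  proof (rule power2_le_imp_le)
    have "0 \<le> (Y_norm \<Omega> \<alpha> e - Y_norm \<Omega> \<alpha> w)\<^sup>2" by simp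
    then show "(Y_norm \<Omega> \<alpha> e + Y_norm \<Omega> \<alpha> w)\<^sup>2 \<le> (sqrt 2 * X_h_norm \<Omega> \<alpha> v Yh e)\<^sup>2"
      by (simp add: X_h_norm_def power_mult_distrib power2_sum power2_diff flip: w_def)
  qed (simp add: X_h_norm_def)
  finally show ?thesis
    by (simp add: e_def field_simps)
qed

end
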